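(* Let $1<p<\infty$, let $q=p/(p-1)$, and let $\widehat{p}=\max(p-1,1)$. Let $\omega$ be a real function analytic in a (complex) neighborhood of $[0,\infty)$ that is positive, non-increasing and non-constant on $[0,\infty)$. Suppose that $\lim_{r\to\infty}r^n\omega(r^2)=\lim_{r\to\infty}r^n\omega'(r^2)=0$ for all integers $n$, and that the polynomials are dense in $A^p_\infty(\omega(|z|^2))$ and in $A^q_\infty(\omega(|z|^2)-|z|^2\omega'(|z|^2))$. Let $k\in A^q_\infty(\omega(|z|^2))$ be nonzero and let $f$ be the extremal function in $A^p_\infty(\omega(|z|^2))$ for the integral kernel $k$. Then \[ D_p(\infty,f)\le\left[\frac{\widehat{p}}{\|k\|^*}\,D_q(\infty,k)\right]^{1/(p-1)} . \]
   Context: $dA$ is area measure on $\mathbb{C}$. For a nonnegative weight $\nu$ on $\mathbb{C}$, $A^p_\infty(\nu)$ is the space of entire functions $g$ with $\|g\|=\left(\int_{\mathbb{C}}|g|^p\nu\,dA\right)^{1/p}<\infty$. For $k\in A^q_\infty(\nu)$, $\Phi_k(g)=\int_{\mathbb{C}}g\,\overline{k}\,\nu\,dA$ is a bounded linear functional on $A^p_\infty(\nu)$, and $\|k\|^*$ is its operator norm. The extremal function for the kernel $k$ is the (unique) $f\in A^p_\infty(\nu)$ with $\|f\|=1$ and $\operatorname{Re}\Phi_k(f)=\sup\{\operatorname{Re}\Phi_k(g):\|g\|=1\}$. For an entire function $g$, $D_p(\infty,g)=\left(-\int_{\mathbb{C}}|z|^2|g(z)|^p\,\omega'(|z|^2)\,dA(z)\right)^{1/p}$.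 *)

theory Defs
  imports "HOL-Analysis.Analysis" "HOL-Computational_Algebra.Polynomial"
begin

definition Ap_space :: "real \<Rightarrow> (complex \<Rightarrow> real) \<Rightarrow> (complex \<Rightarrow> complex) set" where
  "Ap_space p \<nu> = {g. g holomorphic_on UNIV \<and>
      integrable lborel (\<lambda>z. norm (g z) powr p * \<nu> z)}"

definition Ap_norm :: "real \<Rightarrow> (complex \<Rightarrow> real) \<Rightarrow> (complex \<Rightarrow> complex) \<Rightarrow> real" where
  "Ap_norm p \<nu> g = (\<integral>z. norm (g z) powr p * \<nu> z \<partial>lborel) powr (1 / p)"

definition Phi :: "(complex \<Rightarrow> real) \<Rightarrow> (complex \<Rightarrow> complex) \<Rightarrow> (complex \<Rightarrow> complex) \<Rightarrow> complex" where
  "Phi \<nu> k g = (\<integral>z. g z * cnj (k z) * complex_of_real (\<nu> z) \<partial>lborel)"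

definition dual_norm :: "real \<Rightarrow> (complex \<Rightarrow> real) \<Rightarrow> (complex \<Rightarrow> complex) \<Rightarrow> real" where
  "dual_norm p \<nu> k = Sup {norm (Phi \<nu> k g) | g. g \<in> Ap_space p \<nu> \<and> Ap_norm p \<nu> g \<le> 1}"

definition is_extremal :: "real \<Rightarrow> (complex \<Rightarrow> real) \<Rightarrow> (complex \<Rightarrow> complex) \<Rightarrow> (complex \<Rightarrow> complex) \<Rightarrow> bool" where
  "is_extremal p \<nu> k f \<longleftrightarrow> f \<in> Ap_space p \<nu> \<and> Ap_norm p \<nu> f = 1 \<and>
     Re (Phi \<nu> k f) = Sup {Re (Phi \<nu> k g) | g. g \<in> Ap_space p \<nu> \<and> Ap_norm p \<nu> g = 1}"

definition polys_dense :: "real \<Rightarrow> (complex \<Rightarrow> real) \<Rightarrow> bool" where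
  "polys_dense p \<nu> \<longleftrightarrow> (\<forall>g \<in> Ap_space p \<nu>. \<forall>\<epsilon>>0. \<exists>P :: complex poly.
      poly P \<in> Ap_space p \<nu> \<and> Ap_norm p \<nu> (\<lambda>z. g z - poly P z) < \<epsilon>)"

definition analytic_near_halfline :: "(real \<Rightarrow> real) \<Rightarrow> bool" where
  "analytic_near_halfline \<omega> \<longleftrightarrow> (\<exists>U W. open U \<and> complex_of_real ` {0..} \<subseteq> U \<and>
      W holomorphic_on U \<and> (\<forall>x. complex_of_real x \<in> U \<longrightarrow> W (complex_of_real x) = complex_of_real (\<omega> x)))"

definition D_integrand :: "(real \<Rightarrow> real) \<Rightarrow> real \<Rightarrow> (complex \<Rightarrow> complex) \<Rightarrow> complex \<Rightarrow> real" where
  "D_integrand \<omega> p g z = - ((cmod z)^2 * norm (g z) powr p * deriv \<omega> ((cmod z)^2))"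

definition D_inf :: "(real \<Rightarrow> real) \<Rightarrow> real \<Rightarrow> (complex \<Rightarrow> complex) \<Rightarrow> real" where
  "D_inf \<omega> p g = (\<integral>z. D_integrand \<omega> p g z \<partial>lborel) powr (1 / p)"

end

theory Submission
  imports Defs "HOL-Complex_Analysis.Complex_Analysis" "HOL-Probability.Sinc_Integral"
begin

text \<open>
  Write \<open>\<nu>(z) = \<omega>(|z|\<^sup>2)\<close>, \<open>\<kappa>(z) = -|z|\<^sup>2 \<omega>'(|z|\<^sup>2)\<close>, \<open>S = \<parallel>k\<parallel>\<^sup>* = Re \<Phi>\<^sub>k(f)\<close> and
  \<open>f\<^sub>r(z) = f(r z)\<close>. Testing the extremal problem with \<open>f\<^sub>r\<close> gives
  \<open>S (1 - r \<parallel>f\<^sub>r\<parallel>) \<le> Re (\<Phi>\<^sub>k(f) - r \<Phi>\<^sub>k(f\<^sub>r))\<close>. Powers of \<open>z\<close> are orthogonal for radial weights, so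
  \<open>r \<Phi>\<^sub>k(f\<^sub>r)\<close> is the integral of \<open>f\<close> times the conjugate of \<open>k\<close> against \<open>\<nu>(w/\<surd>r)\<close>, and Hoelder's inequality
  bounds the right-hand side by \<open>A(\<surd>r)\<^bsup>1/p\<^esup> B(\<surd>r)\<^bsup>1/q\<^esup>\<close>, where \<open>A(s)\<close> and \<open>B(s)\<close> are the integrals of
  \<open>|f|\<^sup>p\<close> and \<open>|k|\<^sup>q\<close> against \<open>\<nu>(w) - \<nu>(w/s)\<close>. Since \<open>2\<kappa>\<close> is the derivative of \<open>\<nu>(w/s)\<close> at \<open>s = 1\<close>
  and the circular means of \<open>|g|\<^sup>p\<close> increase with the radius, \<open>A(s) \<le> (1 - s\<^sup>2) D\<close> with
  \<open>D = D\<^sub>p(\<infinity>,f)\<^sup>p\<close>, and likewise for \<open>B\<close>. Moreover \<open>r \<parallel>f\<^sub>r\<parallel> = r\<^bsup>1-2/p\<^esup> (1 - A(r))\<^bsup>1/p\<^esup>\<close>.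
  Dividing by \<open>1 - r\<close> first bounds \<open>A(r)/(1 - r)\<close>, so that \<open>D\<close> is finite by Fatou's lemma; letting
  \<open>r \<rightarrow> 1\<close> then yields \<open>2D + p - 2 \<le> p S\<^sup>-\<^sup>1 D\<^sub>q(\<infinity>,k) D\<^bsup>1/p\<^esup>\<close>, which together with \<open>D \<ge> 1\<close> gives
  the claim.
\<close>

section \<open>Rotations and dilations of Lebesgue measure on the plane\<close>

text \<open>Opens the way to iterated integrals in real coordinates: Lebesgue measure on the plane
  is determined by its values on boxes, and boxes pull back to products of intervals.\<close>

lemma lborel_complex_eq_distr:
  "(lborel :: complex measure) = distr (lborel \<Otimes>\<^sub>M lborel) borel (\<lambda>(x, y). Complex x y)"
proof (rule lborel_eqI)
  fix l u :: complex
  assume le: "\<And>b. b \<in> Basis \<Longrightarrow> l \<bullet> b \<le> u \<bullet> b"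
  have le': "Re l \<le> Re u" "Im l \<le> Im u"
    using le[of 1] le[of \<i>] by (auto simp: Basis_complex_def)
  have meas: "(\<lambda>(x, y). Complex x y) \<in> borel_measurable (lborel \<Otimes>\<^sub>M lborel)"
    unfolding lborel_prod by (auto simp: Complex_eq split_beta' intro!: borel_measurable_continuous_onI continuous_intros)
  have pre: "(\<lambda>(x, y). Complex x y) -` box l u \<inter> space (lborel \<Otimes>\<^sub>M lborel)
      = {Re l <..< Re u} \<times> {Im l <..< Im u}"
    by (auto simp: in_box_complex_iff space_pair_measure)
  show "emeasure (distr (lborel \<Otimes>\<^sub>M lborel) borel (\<lambda>(x, y). Complex x y)) (box l u)
      = (\<Prod>b\<in>Basis. (u - l) \<bullet> b)"
    using le' by (subst emeasure_distr[OF meas]) (auto simp: pre lborel.emeasure_pair_measure_Times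
       Basis_complex_def ennreal_mult)
qed simp

lemma nn_integral_lborel_complex:
  fixes g :: "complex \<Rightarrow> ennreal"
  assumes [measurable]: "g \<in> borel_measurable borel"
  shows "(\<integral>\<^sup>+z. g z \<partial>lborel) = (\<integral>\<^sup>+x. \<integral>\<^sup>+y. g (Complex x y) \<partial>lborel \<partial>lborel)"
    and "(\<integral>\<^sup>+z. g z \<partial>lborel) = (\<integral>\<^sup>+y. \<integral>\<^sup>+x. g (Complex x y) \<partial>lborel \<partial>lborel)"
proof -
  have meas[measurable]: "(\<lambda>(x, y). Complex x y) \<in> borel_measurable (lborel \<Otimes>\<^sub>M lborel)"
    unfolding lborel_prod by (auto simp: Complex_eq split_beta' intro!: borel_measurable_continuous_onI continuous_intros)
  have "(\<integral>\<^sup>+z. g z \<partial>lborel) = (\<integral>\<^sup>+w. g (case w of (x, y) \<Rightarrow> Complex x y) \<partial>(lborel \<Otimes>\<^sub>M lborel))"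
    by (subst lborel_complex_eq_distr) (simp add: nn_integral_distr)
  also have "\<dots> = (\<integral>\<^sup>+x. \<integral>\<^sup>+y. g (Complex x y) \<partial>lborel \<partial>lborel)"
    by (subst lborel.nn_integral_fst[symmetric]) (auto simp: split_beta')
  finally show 1: "(\<integral>\<^sup>+z. g z \<partial>lborel) = (\<integral>\<^sup>+x. \<integral>\<^sup>+y. g (Complex x y) \<partial>lborel \<partial>lborel)" .
  show "(\<integral>\<^sup>+z. g z \<partial>lborel) = (\<integral>\<^sup>+y. \<integral>\<^sup>+x. g (Complex x y) \<partial>lborel \<partial>lborel)"
    unfolding 1 by (rule lborel_pair.Fubini'[symmetric]) (simp add: split_beta')
qed

text \<open>A rotation splits into one-dimensional affine substitutions. For nonzero
  \<open>a\<close>, substitute in \<open>x\<close> with \<open>y\<close> fixed, exchange the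
  integrals, then substitute in \<open>y\<close> with \<open>x\<close> fixed; the factors 1/|a| and
  |a| cancel. For \<open>a = 0\<close> the rotation swaps the axes up to sign.\<close>

lemma nn_integral_lborel_rotate:
  fixes g :: "complex \<Rightarrow> ennreal"
  assumes [measurable]: "g \<in> borel_measurable borel" and c: "cmod c = 1"
  shows "(\<integral>\<^sup>+z. g (c * z) \<partial>lborel) = (\<integral>\<^sup>+z. g z \<partial>lborel)"
proof -
  define a b where "a = Re c" and "b = Im c"
  have ab: "a\<^sup>2 + b\<^sup>2 = 1" using c by (simp add: a_def b_def cmod_def)
  have mC[measurable]: "(\<lambda>w. Complex (fst w) (snd w)) \<in> borel_measurable (borel \<Otimes>\<^sub>M borel)"
    unfolding borel_prod by (auto simp: Complex_eq intro!: borel_measurable_continuous_onI continuous_intros)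
  have mC': "(\<lambda>x. Complex (u x) (v x)) \<in> borel_measurable M"
    if [measurable]: "u \<in> borel_measurable M" "v \<in> borel_measurable M" for u v and M :: "'x measure"
    using measurable_compose[OF measurable_Pair[OF that] mC] by simp
  note [measurable] = mC'
  have mult: "c * Complex x y = Complex (- b * y + a * x) (b * x + a * y)" for x y
    by (simp add: complex_eq_iff a_def b_def)
  have "(\<integral>\<^sup>+z. g (c * z) \<partial>lborel) =
      (\<integral>\<^sup>+y. \<integral>\<^sup>+x. g (Complex (- b * y + a * x) (b * x + a * y)) \<partial>lborel \<partial>lborel)"
    by (subst nn_integral_lborel_complex(2)) (simp_all add: mult)
  also have "\<dots> = (\<integral>\<^sup>+z. g z \<partial>lborel)"
  proof (cases "a = 0")
    case True
    hence b: "b \<noteq> 0" "\<bar>b\<bar> = 1" using ab by (auto simp: abs_square_eq_1)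
    have "(\<integral>\<^sup>+y. \<integral>\<^sup>+x. g (Complex (- b * y + a * x) (b * x + a * y)) \<partial>lborel \<partial>lborel)
        = (\<integral>\<^sup>+y. \<integral>\<^sup>+x. g (Complex (- b * y) x) \<partial>lborel \<partial>lborel)"
      using b by (subst nn_integral_real_affine[where c = b and t = 0 and f = "\<lambda>x. g (Complex _ x)"])
                 (auto simp: True)
    also have "\<dots> = (\<integral>\<^sup>+y. \<integral>\<^sup>+x. g (Complex y x) \<partial>lborel \<partial>lborel)"
      using b by (subst (2) nn_integral_real_affine[where c = "-b" and t = 0]) auto
    finally show ?thesis by (simp add: nn_integral_lborel_complex(1))
  next
    case False
    have "(\<integral>\<^sup>+y. \<integral>\<^sup>+x. g (Complex (- b * y + a * x) (b * x + a * y)) \<partial>lborel \<partial>lborel)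
        = (\<integral>\<^sup>+y. ennreal (1 / \<bar>a\<bar>) * \<integral>\<^sup>+x. g (Complex x (b / a * x + 1 / a * y)) \<partial>lborel \<partial>lborel)"
    proof (rule nn_integral_cong)
      fix y
      \<comment> \<open>The second coordinate rewritten in the new variable; this is where
        \<open>a\<^sup>2 + b\<^sup>2 = 1\<close> enters.\<close>
      have eq: "b / a * (- b * y + a * x) + 1 / a * y = b * x + a * y" for x
      proof -
        have "b / a * (- b * y + a * x) + 1 / a * y = b * x + (1 - b\<^sup>2) / a * y"
          using False by (simp add: field_simps power2_eq_square)
        also have "1 - b\<^sup>2 = a * a" using ab by (simp add: power2_eq_square)
        finally show ?thesis using False by simp
      qed
      have "(\<integral>\<^sup>+x. g (Complex x (b / a * x + 1 / a * y)) \<partial>lborel) =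
         ennreal \<bar>a\<bar> * (\<integral>\<^sup>+x. g (Complex (- b * y + a * x) (b * x + a * y)) \<partial>lborel)"
        using False
        by (subst nn_integral_real_affine[where c = a and t = "- b * y"]) (simp_all only: eq, auto)
      thus "(\<integral>\<^sup>+x. g (Complex (- b * y + a * x) (b * x + a * y)) \<partial>lborel) =
         ennreal (1 / \<bar>a\<bar>) * \<integral>\<^sup>+x. g (Complex x (b / a * x + 1 / a * y)) \<partial>lborel"
        using False by (simp add: mult.assoc[symmetric] ennreal_mult[symmetric])
    qed
    also have "\<dots> = (\<integral>\<^sup>+y. \<integral>\<^sup>+x. ennreal (1 / \<bar>a\<bar>) * g (Complex x (b / a * x + 1 / a * y)) \<partial>lborel \<partial>lborel)"
      by (intro nn_integral_cong nn_integral_cmult[symmetric]) auto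
    also have "\<dots> = (\<integral>\<^sup>+x. \<integral>\<^sup>+y. ennreal (1 / \<bar>a\<bar>) * g (Complex x (b / a * x + 1 / a * y)) \<partial>lborel \<partial>lborel)"
      by (rule lborel_pair.Fubini') (auto simp: split_beta')
    also have "\<dots> = (\<integral>\<^sup>+x. \<integral>\<^sup>+y. g (Complex x y) \<partial>lborel \<partial>lborel)"
    proof (rule nn_integral_cong)
      fix x
      show "(\<integral>\<^sup>+y. ennreal (1 / \<bar>a\<bar>) * g (Complex x (b / a * x + 1 / a * y)) \<partial>lborel)
          = (\<integral>\<^sup>+y. g (Complex x y) \<partial>lborel)"
        using False by (subst (2) nn_integral_real_affine[where c = "1 / a" and t = "b / a * x"])
           (auto simp: nn_integral_cmult)
    qed
    finally show ?thesis by (simp add: nn_integral_lborel_complex(1))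
  qed
  finally show ?thesis .
qed

lemma distr_lborel_rotate:
  assumes "cmod c = 1"
  shows "distr lborel borel ((*) c) = (lborel :: complex measure)"
proof (rule measure_eqI)
  fix A assume "A \<in> sets (distr lborel borel ((*) c))"
  hence A[measurable]: "A \<in> sets borel" by simp
  have "emeasure (distr lborel borel ((*) c)) A = (\<integral>\<^sup>+z. indicator A (c * z) \<partial>lborel)"
    by (simp flip: nn_integral_indicator add: nn_integral_distr)
  also have "\<dots> = (\<integral>\<^sup>+z. indicator A z \<partial>lborel)"
    by (rule nn_integral_lborel_rotate) (use assms in auto)
  finally show "emeasure (distr lborel borel ((*) c)) A = emeasure lborel A" by simp
qed simp

lemma nn_integral_lborel_dilate:
  fixes g :: "complex \<Rightarrow> ennreal"
  assumes [measurable]: "g \<in> borel_measurable borel" and s: "s > 0"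
  shows "(\<integral>\<^sup>+z. g z \<partial>lborel) = ennreal (s\<^sup>2) * (\<integral>\<^sup>+z. g (of_real s * z) \<partial>lborel)"
  by (subst lborel_affine[of s 0]) (use s in \<open>simp_all add: nn_integral_density nn_integral_distr
     nn_integral_cmult scaleR_conv_of_real\<close>)

lemma integral_lborel_dilate:
  fixes g :: "complex \<Rightarrow> complex"
  assumes [measurable]: "g \<in> borel_measurable borel" and s: "s > 0"
  shows "(\<integral>z. g z \<partial>lborel) = of_real (s\<^sup>2) * (\<integral>z. g (of_real s * z) \<partial>lborel)"
proof -
  have "(\<integral>z. g z \<partial>lborel) = (\<integral>z. g z \<partial>density (distr lborel borel (\<lambda>x. 0 + s *\<^sub>R x)) (\<lambda>_. \<bar>s\<bar> ^ DIM(complex)))"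
    using s by (subst lborel_affine[of s 0]) auto
  also have "\<dots> = (\<integral>z. \<bar>s\<bar> ^ 2 *\<^sub>R g (s *\<^sub>R z) \<partial>lborel)"
    by (subst integral_density) (auto simp: integral_distr)
  finally show ?thesis by (simp add: scaleR_conv_of_real)
qed

text \<open>Every rotation preserves the integral, so averaging over the angle changes nothing. For
  radial weights this reduces comparisons of plane integrals to comparisons on single
  circles.\<close>

lemma nn_integral_rotation_average:
  fixes g :: "complex \<Rightarrow> ennreal"
  assumes [measurable]: "g \<in> borel_measurable borel"
  shows "(\<integral>\<^sup>+z. g z \<partial>lborel) = (\<integral>\<^sup>+z. \<integral>\<^sup>+t. indicator {0..1} t * g (cis (2 * pi * t) * z) \<partial>lborel \<partial>lborel)"
proof -
  have [measurable]: "cis \<in> borel_measurable borel"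
    by (intro borel_measurable_continuous_onI continuous_intros)
  have "(\<integral>\<^sup>+z. \<integral>\<^sup>+t. indicator {0..1} t * g (cis (2 * pi * t) * z) \<partial>lborel \<partial>lborel)
      = (\<integral>\<^sup>+t. \<integral>\<^sup>+z. indicator {0..1} t * g (cis (2 * pi * t) * z) \<partial>lborel \<partial>lborel)"
    by (rule lborel_pair.Fubini') (auto simp: split_beta')
  also have "\<dots> = (\<integral>\<^sup>+t. indicator {0..1::real} t * (\<integral>\<^sup>+z. g z \<partial>lborel) \<partial>lborel)"
    by (intro nn_integral_cong) (simp add: nn_integral_cmult nn_integral_lborel_rotate)
  also have "\<dots> = (\<integral>\<^sup>+z. g z \<partial>lborel)"
    by (simp add: nn_integral_multc)
  finally show ?thesis by simp
qed

lemma integral_rotation_average: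
  fixes g :: "complex \<Rightarrow> complex"
  assumes g: "integrable lborel g"
  shows "(\<integral>z. g z \<partial>lborel) = (\<integral>z. (\<integral>t. indicator {0..1} t *\<^sub>R g (cis (2 * pi * t) * z) \<partial>lborel) \<partial>lborel)"
proof -
  have [measurable]: "cis \<in> borel_measurable borel"
    by (intro borel_measurable_continuous_onI continuous_intros)
  have [measurable]: "g \<in> borel_measurable borel" using borel_measurable_integrable[OF g] by simp
  let ?h = "\<lambda>(t::real, z). indicator {0..1} t *\<^sub>R g (cis (2 * pi * t) * z)"
  have rot: "(\<integral>z. g (cis (2 * pi * t) * z) \<partial>lborel) = (\<integral>z. g z \<partial>lborel)" for t
    by (subst (2) distr_lborel_rotate[of "cis (2 * pi * t)", symmetric]) (auto simp: integral_distr)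
  \<comment> \<open>Fubini for a complex integrand needs integrability on the product, which follows
    from rotation invariance of the integral of the norm.\<close>
  have "integrable (lborel \<Otimes>\<^sub>M lborel) ?h"
  proof (rule integrableI_bounded)
    have "(\<integral>\<^sup>+x. ennreal (norm (?h x)) \<partial>(lborel \<Otimes>\<^sub>M lborel))
        = (\<integral>\<^sup>+t. \<integral>\<^sup>+z. indicator {0..1} t * ennreal (norm (g (cis (2 * pi * t) * z))) \<partial>lborel \<partial>lborel)"
      by (subst lborel.nn_integral_fst[symmetric])
         (auto simp: split_beta' ennreal_mult ennreal_indicator intro!: nn_integral_cong split: split_indicator)
    also have "\<dots> = (\<integral>\<^sup>+t. indicator {0..1} t * (\<integral>\<^sup>+z. ennreal (norm (g z)) \<partial>lborel) \<partial>(lborel::real measure))"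
      by (intro nn_integral_cong)
         (simp add: nn_integral_cmult nn_integral_lborel_rotate[where g = "\<lambda>z. ennreal (norm (g z))"])
    also have "\<dots> < \<infinity>"
      using g by (simp add: nn_integral_multc integrable_iff_bounded)
    finally show "(\<integral>\<^sup>+x. ennreal (norm (?h x)) \<partial>(lborel \<Otimes>\<^sub>M lborel)) < \<infinity>" .
  qed (simp add: split_beta')
  hence "(\<integral>z. (\<integral>t. ?h (t, z) \<partial>lborel) \<partial>lborel) = (\<integral>t. (\<integral>z. ?h (t, z) \<partial>lborel) \<partial>lborel)"
    by (intro lborel_pair.Fubini_integral) (simp add: split_beta')
  also have "\<dots> = (\<integral>t. indicator {0..1::real} t *\<^sub>R (\<integral>z. g z \<partial>lborel) \<partial>lborel)"
    by (simp add: rot)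
  also have "\<dots> = (\<integral>z. g z \<partial>lborel)"
    by simp
  finally show ?thesis by simp
qed

section \<open>Means over circles\<close>

text \<open>Multiplication by \<open>c = cis (2 * pi * a)\<close> shifts a function of period 1 by
  \<open>a\<close>; the piece of the shifted interval beyond 1 returns to \<open>{0..a}\<close> by
  periodicity.\<close>

lemma integral_circle_rotate:
  fixes \<phi> :: "complex \<Rightarrow> real"
  assumes \<phi>: "continuous_on UNIV \<phi>" and c: "cmod c = 1"
  shows "integral {0..1} (\<lambda>t. \<phi> (c * cis (2 * pi * t))) = integral {0..1} (\<lambda>t. \<phi> (cis (2 * pi * t)))"
proof -
  define a where "a = Arg2pi c / (2 * pi)"
  have a: "0 \<le> a" "a \<le> 1" using Arg2pi_ge_0[of c] Arg2pi_lt_2pi[of c] by (auto simp: a_def field_simps)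
  have ca: "c = cis (2 * pi * a)"
    using Arg2pi_eq[of c] c by (simp add: a_def cis_conv_exp mult.commute)
  define \<psi> where "\<psi> t = \<phi> (cis (2 * pi * t))" for t
  have cont: "continuous_on A \<psi>" for A
    unfolding \<psi>_def by (intro continuous_on_compose2[OF \<phi>] continuous_intros) auto
  have per: "\<psi> (t + 1) = \<psi> t" for t
    using cis_mult[of "2 * pi * t" "2 * pi"] by (simp add: \<psi>_def distrib_left)
  have shift: "integral {l..u} (\<lambda>t. \<psi> (t + d)) = integral {l + d..u + d} \<psi>" for l u d
    using integral_shift_Icc_real[of l u \<psi> d] by (simp add: o_def add.commute)
  have int: "\<psi> integrable_on {l..u}" for l u
    using cont by (intro integrable_continuous_interval)
  have "integral {0..1} (\<lambda>t. \<phi> (c * cis (2 * pi * t))) = integral {a..1 + a} \<psi>"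
    using shift[of 0 1 a] by (simp add: \<psi>_def ca cis_mult algebra_simps)
  also have "\<dots> = integral {a..1} \<psi> + integral {1..1 + a} \<psi>"
    using a by (intro Henstock_Kurzweil_Integration.integral_combine[symmetric] int) auto
  also have "integral {1..1 + a} \<psi> = integral {0..a} \<psi>"
    using shift[of 0 a 1] by (simp add: per add.commute)
  also have "integral {a..1} \<psi> + integral {0..a} \<psi> = integral {0..1} \<psi>"
    using a by (subst add.commute, intro Henstock_Kurzweil_Integration.integral_combine int) auto
  finally show ?thesis by (simp add: \<psi>_def[abs_def])
qed

lemma continuous_on_norm_powr:
  fixes g :: "'a::topological_space \<Rightarrow> 'b::real_normed_vector"
  assumes "continuous_on A g" "p > 0"
  shows "continuous_on A (\<lambda>x. norm (g x) powr p)"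
  using assms by (intro continuous_on_powr' continuous_intros) auto

text \<open>At 0 the jump of \<open>sgn\<close> is harmless, because the modulus of the product is
  at most \<open>cmod v powr p\<close>, which tends to 0.\<close>

lemma continuous_norm_powr_cnj_sgn:
  assumes "p > 0"
  shows "continuous_on UNIV (\<lambda>v. of_real (cmod v powr p) * cnj (sgn v))"
proof -
  have "isCont (\<lambda>v. of_real (cmod v powr p) * cnj (sgn v)) v" for v
  proof (cases "v = 0")
    case True
    have "((\<lambda>v. cmod v powr p) \<longlongrightarrow> cmod 0 powr p) (at 0)"
      using continuous_on_norm_powr[of UNIV "\<lambda>x::complex. x" p] assms
      by (auto simp: continuous_on_eq_continuous_at isCont_def simp del: norm_zero)
    hence lim: "((\<lambda>v::complex. cmod v powr p) \<longlongrightarrow> 0) (at 0)" using assms by simp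
    have "((\<lambda>v. of_real (cmod v powr p) * cnj (sgn v)) \<longlongrightarrow> 0) (at 0)"
      by (rule Lim_null_comparison[OF always_eventually lim]) (simp add: norm_mult norm_sgn)
    thus ?thesis using assms by (simp add: isCont_def True)
  next
    case False
    thus ?thesis by (intro continuous_intros) auto
  qed
  thus ?thesis by (simp add: continuous_on_eq_continuous_at)
qed

text \<open>Testing \<open>g\<close> against the dual power \<open>h\<close> of its values on the inner circle gives a holomorphic
  function of the dilation parameter, to which the maximum modulus principle applies.\<close>

lemma circle_mean_mono:
  assumes g: "g holomorphic_on UNIV" and p: "p > 1" and s: "0 \<le> s" "s \<le> 1"
  shows "integral {0..1} (\<lambda>t. cmod (g (of_real s * cis (2 * pi * t))) powr p)
       \<le> integral {0..1} (\<lambda>t. cmod (g (cis (2 * pi * t))) powr p)"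
proof -
  define q where "q = p / (p - 1)"
  have q: "q > 1" "1 / p + 1 / q = 1" "(p - 1) * q = p" using p by (auto simp: q_def field_simps)
  have cg: "continuous_on A g" for A
    using g holomorphic_on_imp_continuous_on continuous_on_subset by blast
  have cg': "continuous_on A (deriv g)" for A
    using holomorphic_on_imp_continuous_on[OF holomorphic_deriv[OF g]] continuous_on_subset by blast
  \<comment> \<open>Chosen so that on the inner circle its product with \<open>g\<close> is |g|^p,
    while |h|^q = |g|^p because \<open>(p - 1) * q = p\<close>.\<close>
  define h where "h t = (let v = g (of_real s * cis (2 * pi * t)) in of_real (cmod v powr (p - 1)) * cnj (sgn v))" for t
  have ch: "continuous_on A h" for A
    unfolding h_def Let_def
    by (rule continuous_on_compose2[OF continuous_norm_powr_cnj_sgn])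
       (use p in \<open>auto intro!: continuous_on_compose2[OF cg[of UNIV]] continuous_intros\<close>)
  have nh: "cmod (h t) = cmod (g (of_real s * cis (2 * pi * t))) powr (p - 1)" for t
    using p by (simp add: h_def Let_def norm_mult norm_sgn)
  \<comment> \<open>With \<open>h\<close> frozen, only the argument of \<open>g\<close> depends on
    \<open>\<zeta>\<close>, so differentiation under the integral makes \<open>F\<close>
    entire.\<close>
  define F where "F \<zeta> = integral (cbox 0 1) (\<lambda>t. g (\<zeta> * cis (2 * pi * t)) * h t)" for \<zeta>
  define I where "I \<zeta> = integral {0..1} (\<lambda>t. cmod (g (\<zeta> * cis (2 * pi * t))) powr p)" for \<zeta>
  have cint: "continuous_on A (\<lambda>t. g (\<zeta> * cis (2 * pi * t)))" for A \<zeta>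
    by (auto intro!: continuous_on_compose2[OF cg[of UNIV]] continuous_intros)
  have F: "F holomorphic_on UNIV"
    unfolding F_def
  proof (rule leibniz_rule_holomorphic)
    fix \<zeta> t
    show "((\<lambda>\<zeta>. g (\<zeta> * cis (2 * pi * t)) * h t) has_field_derivative
        deriv g (\<zeta> * cis (2 * pi * t)) * cis (2 * pi * t) * h t) (at \<zeta> within UNIV)"
      by (rule derivative_eq_intros DERIV_chain2[OF holomorphic_derivI[OF g]] refl | simp)+
  next
    show "(\<lambda>t. g (\<zeta> * cis (2 * pi * t)) * h t) integrable_on cbox 0 1" for \<zeta>
      by (intro integrable_continuous continuous_on_mult cint ch)
  next
    show "continuous_on (UNIV \<times> cbox 0 1)
      (\<lambda>(\<zeta>, t). deriv g (\<zeta> * cis (2 * pi * t)) * cis (2 * pi * t) * h t)"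
      unfolding split_beta'
      by (intro continuous_on_mult continuous_on_compose2[OF cg'[of UNIV]] continuous_on_compose2[OF ch[of UNIV]])
         (auto intro!: continuous_intros)
  qed auto
  \<comment> \<open>Young's inequality pointwise in \<open>t\<close>; on the unit circle the mean
    \<open>I \<zeta>\<close> equals \<open>I 1\<close> by rotation.\<close>
  have bound: "cmod (F \<zeta>) \<le> I 1 / p + I (of_real s) / q" if \<zeta>: "cmod \<zeta> = 1" for \<zeta>
  proof -
    have "cmod (F \<zeta>) \<le> integral (cbox 0 1) (\<lambda>t. cmod (g (\<zeta> * cis (2 * pi * t))) powr p / p
        + cmod (g (of_real s * cis (2 * pi * t))) powr p / q)"
      unfolding F_def
    proof (rule integral_norm_bound_integral)
      fix t :: real
      have "cmod (g (\<zeta> * cis (2 * pi * t))) * cmod (h t)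
        \<le> cmod (g (\<zeta> * cis (2 * pi * t))) powr p / p + cmod (h t) powr q / q"
        using p q by (intro Youngs_inequality) auto
      thus "cmod (g (\<zeta> * cis (2 * pi * t)) * h t) \<le> cmod (g (\<zeta> * cis (2 * pi * t))) powr p / p
        + cmod (g (of_real s * cis (2 * pi * t))) powr p / q"
        by (simp add: nh powr_powr q norm_mult)
    qed (use p q in \<open>auto intro!: integrable_continuous_interval continuous_intros continuous_on_norm_powr cint ch\<close>)
    also have "\<dots> = I \<zeta> / p + I (of_real s) / q"
      using p q by (simp, subst integral_add)
        (auto simp: I_def intro!: integrable_continuous_interval continuous_intros continuous_on_norm_powr cint)
    also have "I \<zeta> = I 1"
      using integral_circle_rotate[OF continuous_on_norm_powr[OF cg] \<zeta>, of p] p by (simp add: I_def)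
    finally show ?thesis .
  qed
  have "F (of_real s) = of_real (I (of_real s))"
  proof -
    have *: "v * (of_real (cmod v powr (p - 1)) * cnj (sgn v)) = of_real (cmod v powr p)" for v
    proof (cases "v = 0")
      case False
      have "v * cnj (sgn v) = of_real (cmod v)"
        using complex_norm_square[of v] False
        by (simp add: sgn_eq power2_eq_square field_simps)
      moreover have "cmod v powr p = cmod v powr (p - 1) * cmod v"
        using False by (simp add: powr_diff)
      ultimately show ?thesis by (metis mult.left_commute of_real_mult)
    qed (use p in auto)
    show ?thesis
      unfolding F_def I_def h_def Let_def *
      using p by (simp, intro integral_unique has_integral_of_real integrable_integral)
        (auto intro!: integrable_continuous_interval continuous_on_norm_powr cint)
  qed
  moreover have "cmod (F (of_real s)) \<le> I 1 / p + I (of_real s) / q"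
  proof (rule maximum_modulus_frontier[where S = "cball 0 1" and f = F])
    show "F holomorphic_on interior (cball 0 1)"
      by (rule holomorphic_on_subset[OF F]) auto
    show "continuous_on (closure (cball 0 1)) F"
      by (intro holomorphic_on_imp_continuous_on holomorphic_on_subset[OF F]) auto
  qed (use s bound in auto)
  \<comment> \<open>Since \<open>F\<close> at \<open>s\<close> is the inner mean itself, the term
    with weight \<open>1 / q\<close> is absorbed on the left, leaving weight \<open>1 / p\<close> on
    both sides.\<close>
  ultimately have "I (of_real s) \<le> I 1 / p + I (of_real s) * (1 / q)" by simp
  moreover have "1 / q = 1 - 1 / p" using q by simp
  ultimately have "I (of_real s) \<le> I 1 / p + I (of_real s) * (1 - 1 / p)" by simp
  hence "I (of_real s) \<le> I 1" using p by (simp add: field_simps)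
  thus ?thesis by (simp add: I_def)
qed

text \<open>On each circle about 0, \<open>cnj (of_real (\<rho>\<^sup>2) / w)\<close> is a positive
  multiple of \<open>w\<close>, so the conjugated factor agrees there with a function holomorphic
  off 0. The contour integral of the resulting \<open>H\<close> is then the same for the radii
  \<open>\<rho>\<^sup>2\<close> and \<open>\<rho>\<close>, which give the left and the right
  side.\<close>

lemma circle_integral_cnj_mult:
  assumes K: "K holomorphic_on UNIV" and F: "F holomorphic_on UNIV" and \<rho>: "0 < \<rho>" "\<rho> \<le> 1"
  shows "integral {0..1} (\<lambda>t. F (of_real (\<rho>\<^sup>2) * cis (2 * pi * t)) * cnj (K (cis (2 * pi * t))))
       = integral {0..1} (\<lambda>t. F (of_real \<rho> * cis (2 * pi * t)) * cnj (K (of_real \<rho> * cis (2 * pi * t))))"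
proof -
  define H where "H w = F w * cnj (K (cnj (of_real (\<rho>\<^sup>2) / w))) / w" for w
  have K': "(\<lambda>w. cnj (K (cnj w))) holomorphic_on UNIV"
    by (intro holomorphic_on_compose_cnj_cnj[of K UNIV, unfolded o_def] holomorphic_on_subset[OF K]) auto
  have "(\<lambda>w. cnj (K (cnj (of_real (\<rho>\<^sup>2) / w)))) holomorphic_on UNIV - {0}"
    by (rule holomorphic_on_compose_gen[OF _ K', unfolded o_def]) (auto intro!: holomorphic_intros)
  hence H: "H holomorphic_on UNIV - {0}"
    unfolding H_def by (intro holomorphic_intros holomorphic_on_subset[OF F]) auto
  have eq: "contour_integral (circlepath 0 R) H =
      2 * pi * \<i> * integral {0..1} (\<lambda>t. F (of_real R * cis (2 * pi * t)) * cnj (K (of_real (\<rho>\<^sup>2 / R) * cis (2 * pi * t))))"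
    if R: "R > 0" for R
  proof -
    have e: "exp (2 * of_real pi * \<i> * of_real t) = cis (2 * pi * t)" for t
      by (simp add: cis_conv_exp mult_ac)
    have "contour_integral (circlepath 0 R) H =
        integral {0..1} (\<lambda>t. H (of_real R * cis (2 * pi * t)) * (2 * pi * \<i> * R * cis (2 * pi * t)))"
      unfolding contour_integral_integral
      by (intro integral_cong) (simp only: vector_derivative_circlepath, simp add: circlepath e)
    also have "\<dots> = integral {0..1} (\<lambda>t. 2 * pi * \<i> * (F (of_real R * cis (2 * pi * t)) * cnj (K (of_real (\<rho>\<^sup>2 / R) * cis (2 * pi * t)))))"
    proof (rule integral_cong)
      fix t :: real
      have "cnj (of_real (\<rho>\<^sup>2) / (of_real R * cis (2 * pi * t))) = of_real (\<rho>\<^sup>2 / R) * cis (2 * pi * t)"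
        by (simp add: cis_cnj divide_inverse mult_ac)
      thus "H (of_real R * cis (2 * pi * t)) * (2 * pi * \<i> * R * cis (2 * pi * t)) =
         2 * pi * \<i> * (F (of_real R * cis (2 * pi * t)) * cnj (K (of_real (\<rho>\<^sup>2 / R) * cis (2 * pi * t))))"
        using R by (simp add: H_def del: complex_cnj_divide)
    qed
    finally show ?thesis by (simp add: integral_mult_right)
  qed
  have le: "\<rho>\<^sup>2 \<le> \<rho>" using \<rho> by (simp add: power2_eq_square mult_left_le)
  have "contour_integral (circlepath 0 \<rho>) H = contour_integral (circlepath 0 (\<rho>\<^sup>2)) H"
    by (rule contour_integral_circlepath_eq[OF _ H]) (use \<rho> le in auto)
  thus ?thesis
    using \<rho> by (simp add: eq) (simp add: power2_eq_square)
qed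

text \<open>This is Cauchy's formula for the \<open>n\<close>-th derivative at 0 of
  \<open>k (z * w)\<close> in \<open>w\<close>, conjugated: on the unit circle conjugation turns
  division by a power into multiplication. The chain rule contributes the conjugate of
  \<open>z ^ n\<close>, whence |z|^(2n).\<close>

lemma circle_integral_power_cnj:
  assumes k: "k holomorphic_on UNIV"
  shows "integral {0..1} (\<lambda>t. (cis (2 * pi * t) * z) ^ n * cnj (k (cis (2 * pi * t) * z)))
     = of_real (cmod z ^ (2 * n)) * cnj ((deriv ^^ n) k 0 / fact n)"
proof -
  have zz: "of_real (cmod z ^ (2 * n)) = z ^ n * cnj z ^ n"
    by (simp only: power_mult of_real_power[of "(cmod z)\<^sup>2" n] complex_norm_square power_mult_distrib)
  define K where "K w = k (z * w)" for w
  have K: "K holomorphic_on UNIV"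
    unfolding K_def using holomorphic_on_compose_gen[OF _ k, of "\<lambda>w. z * w" UNIV]
    by (auto simp: o_def intro!: holomorphic_intros)
  have e: "exp (2 * of_real pi * \<i> * of_real t) = cis (2 * pi * t)" for t
    by (simp add: cis_conv_exp mult_ac)
  have "((\<lambda>u. K u / (u - 0) ^ Suc n) has_contour_integral (2 * pi * \<i> / fact n * (deriv ^^ n) K 0)) (circlepath 0 1)"
    by (rule Cauchy_has_contour_integral_higher_derivative_circlepath)
       (use K in \<open>auto intro: holomorphic_on_subset holomorphic_on_imp_continuous_on\<close>)
  hence "((\<lambda>t. K (cis (2 * pi * t)) / cis (2 * pi * t) ^ Suc n * (2 * pi * \<i> * cis (2 * pi * t)))
     has_integral (2 * pi * \<i> / fact n * (deriv ^^ n) K 0)) {0..1}"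
    unfolding has_contour_integral_def
    by (rule has_integral_eq[rotated]) (simp only: vector_derivative_circlepath01 atLeastAtMost_iff, simp add: circlepath e)
  hence "((\<lambda>t. 1 / (2 * pi * \<i>) * (K (cis (2 * pi * t)) / cis (2 * pi * t) ^ Suc n * (2 * pi * \<i> * cis (2 * pi * t))))
     has_integral 1 / (2 * pi * \<i>) * (2 * pi * \<i> / fact n * (deriv ^^ n) K 0)) {0..1}"
    by (rule has_integral_mult_right)
  hence "((\<lambda>t. K (cis (2 * pi * t)) / cis (2 * pi * t) ^ n) has_integral ((deriv ^^ n) K 0 / fact n)) {0..1}"
    by (simp add: field_simps)
  hence "((\<lambda>t. cnj (K (cis (2 * pi * t)) / cis (2 * pi * t) ^ n)) has_integral cnj ((deriv ^^ n) K 0 / fact n)) {0..1}"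
    by (simp only: has_integral_cnj[unfolded o_def])
  hence "((\<lambda>t. z ^ n * cnj (K (cis (2 * pi * t)) / cis (2 * pi * t) ^ n)) has_integral
      z ^ n * cnj ((deriv ^^ n) K 0 / fact n)) {0..1}"
    by (rule has_integral_mult_right)
  also have "(\<lambda>t. z ^ n * cnj (K (cis (2 * pi * t)) / cis (2 * pi * t) ^ n))
     = (\<lambda>t. (cis (2 * pi * t) * z) ^ n * cnj (k (cis (2 * pi * t) * z)))"
  proof
    fix t :: real
    have "cnj (K (cis (2 * pi * t)) / cis (2 * pi * t) ^ n) = cnj (K (cis (2 * pi * t))) * cis (2 * pi * t) ^ n"
      by (simp add: cis_cnj divide_inverse flip: power_inverse)
    thus "z ^ n * cnj (K (cis (2 * pi * t)) / cis (2 * pi * t) ^ n)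
       = (cis (2 * pi * t) * z) ^ n * cnj (k (cis (2 * pi * t) * z))"
      by (simp only: K_def power_mult_distrib mult_ac)
  qed
  also have "(deriv ^^ n) K 0 = z ^ n * (deriv ^^ n) k 0"
    unfolding K_def using higher_deriv_compose_linear[OF k, of UNIV 0 z n] by simp
  also have "z ^ n * cnj (z ^ n * (deriv ^^ n) k 0 / fact n) = of_real (cmod z ^ (2 * n)) * cnj ((deriv ^^ n) k 0 / fact n)"
    using zz by (simp add: power_mult_distrib)
  finally show ?thesis by (rule integral_unique)
qed

section \<open>Dilations and radial weights\<close>

lemma holomorphic_on_UNIV_mult_arg:
  assumes "g holomorphic_on UNIV"
  shows "(\<lambda>w. g (c * w)) holomorphic_on UNIV"
  using holomorphic_on_compose_gen[OF _ assms, of "\<lambda>w. c * w" UNIV]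
  by (auto simp: o_def intro!: holomorphic_intros)

lemma borel_measurable_holomorphic_UNIV:
  "g holomorphic_on UNIV \<Longrightarrow> g \<in> borel_measurable borel"
  by (intro borel_measurable_continuous_onI holomorphic_on_imp_continuous_on)

text \<open>Averaging over rotations takes the radial factor \<open>W\<close> out of the angular
  integral, and on each circle \<open>circle_mean_mono\<close> applies to \<open>g (z * w)\<close>
  as a function of \<open>w\<close>. Extended nonnegative values spare any finiteness
  assumption.\<close>

lemma nn_integral_dilate_mono:
  assumes g: "g holomorphic_on UNIV" and p: "p > 1" and s: "0 \<le> s" "s \<le> 1"
    and W[measurable]: "W \<in> borel_measurable borel"
    and rad: "\<And>c z. cmod c = 1 \<Longrightarrow> W (c * z) = (W z :: ennreal)"
  shows "(\<integral>\<^sup>+z. ennreal (cmod (g (of_real s * z)) powr p) * W z \<partial>lborel)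
       \<le> (\<integral>\<^sup>+z. ennreal (cmod (g z) powr p) * W z \<partial>lborel)"
proof -
  have [measurable]: "g \<in> borel_measurable borel"
    by (rule borel_measurable_holomorphic_UNIV[OF g])
  have [measurable]: "cis \<in> borel_measurable borel"
    by (intro borel_measurable_continuous_onI continuous_intros)
  have cg: "continuous_on A g" for A
    using g holomorphic_on_imp_continuous_on continuous_on_subset by blast
  have avg: "(\<integral>\<^sup>+z. ennreal (cmod (g (of_real s * z)) powr p) * W z \<partial>lborel)
     = (\<integral>\<^sup>+z. ennreal (integral {0..1} (\<lambda>t. cmod (g (of_real s * (cis (2 * pi * t) * z))) powr p)) * W z \<partial>lborel)"
    for s :: real
  proof -
    have "(\<integral>\<^sup>+t. indicator {0..1} t * (ennreal (cmod (g (of_real s * (cis (2 * pi * t) * z))) powr p) * W (cis (2 * pi * t) * z)) \<partial>lborel)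
      = ennreal (integral {0..1} (\<lambda>t. cmod (g (of_real s * (cis (2 * pi * t) * z))) powr p)) * W z" for z
    proof -
      have "(\<integral>\<^sup>+t. indicator {0..1} t * (ennreal (cmod (g (of_real s * (cis (2 * pi * t) * z))) powr p) * W (cis (2 * pi * t) * z)) \<partial>lborel)
        = (\<integral>\<^sup>+t. ennreal (cmod (g (of_real s * (cis (2 * pi * t) * z))) powr p) * indicator {0..1} t * W z \<partial>lborel)"
        by (intro nn_integral_cong) (simp add: rad, simp add: mult_ac)
      also have "\<dots> = (\<integral>\<^sup>+t. ennreal (cmod (g (of_real s * (cis (2 * pi * t) * z))) powr p) * indicator {0..1} t \<partial>lborel) * W z"
        by (rule nn_integral_multc) measurable
      also have "(\<integral>\<^sup>+t. ennreal (cmod (g (of_real s * (cis (2 * pi * t) * z))) powr p) * indicator {0..1} t \<partial>lborel)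
        = ennreal (integral {0..1} (\<lambda>t. cmod (g (of_real s * (cis (2 * pi * t) * z))) powr p))"
        using p by (intro nn_integral_has_integral_lebesgue' integrable_integral integrable_continuous_interval
            continuous_on_norm_powr continuous_on_compose2[OF cg[of UNIV]]) (auto intro!: continuous_intros)
      finally show ?thesis .
    qed
    thus ?thesis by (subst nn_integral_rotation_average) simp_all
  qed
  have "(\<integral>\<^sup>+z. ennreal (cmod (g (of_real s * z)) powr p) * W z \<partial>lborel)
      \<le> (\<integral>\<^sup>+z. ennreal (cmod (g (of_real 1 * z)) powr p) * W z \<partial>lborel)"
    unfolding avg
  proof (intro nn_integral_mono mult_right_mono ennreal_leI)
    fix z
    show "integral {0..1} (\<lambda>t. cmod (g (of_real s * (cis (2 * pi * t) * z))) powr p)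
       \<le> integral {0..1} (\<lambda>t. cmod (g (of_real 1 * (cis (2 * pi * t) * z))) powr p)"
      using circle_mean_mono[OF holomorphic_on_UNIV_mult_arg[OF g, of z] p s] by (simp add: mult_ac)
  qed auto
  thus ?thesis by simp
qed

text \<open>Rotational averaging reduces the claim to \<open>circle_integral_cnj_mult\<close> on
  each circle; both integrands must be integrable for the averaging.\<close>

lemma integral_cnj_mult_dilate:
  assumes k: "k holomorphic_on UNIV" and f: "f holomorphic_on UNIV" and \<rho>: "0 < \<rho>" "\<rho> \<le> 1"
    and rad: "\<And>c z. cmod c = 1 \<Longrightarrow> W (c * z) = W z"
    and int1: "integrable lborel (\<lambda>z. f (of_real (\<rho>\<^sup>2) * z) * cnj (k z) * W z)"
    and int2: "integrable lborel (\<lambda>z. f (of_real \<rho> * z) * cnj (k (of_real \<rho> * z)) * W z)"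
  shows "(\<integral>z. f (of_real (\<rho>\<^sup>2) * z) * cnj (k z) * W z \<partial>lborel)
       = (\<integral>z. f (of_real \<rho> * z) * cnj (k (of_real \<rho> * z)) * W z \<partial>lborel)"
proof -
  have ck: "continuous_on A k" and cf: "continuous_on A f" for A
    using k f holomorphic_on_imp_continuous_on continuous_on_subset by blast+
  have avg: "(\<integral>t. indicator {0..1} t *\<^sub>R (f (of_real a * (cis (2 * pi * t) * z)) * cnj (k (of_real b * (cis (2 * pi * t) * z))) * W (cis (2 * pi * t) * z)) \<partial>lborel)
     = integral {0..1} (\<lambda>t. f (of_real a * (cis (2 * pi * t) * z)) * cnj (k (of_real b * (cis (2 * pi * t) * z)))) * W z"
    for a b :: real and z
  proof -
    have "set_integrable lborel {0..1} (\<lambda>t. f (of_real a * (cis (2 * pi * t) * z)) * cnj (k (of_real b * (cis (2 * pi * t) * z))))"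
      by (intro borel_integrable_atLeastAtMost' continuous_on_mult continuous_on_cnj
         continuous_on_compose2[OF cf[of UNIV]] continuous_on_compose2[OF ck[of UNIV]]) (auto intro!: continuous_intros)
    from set_borel_integral_eq_integral(2)[OF this] show ?thesis
      by (simp add: set_lebesgue_integral_def rad flip: scaleR_scaleR mult_scaleR_left)
  qed
  \<comment> \<open>The factor \<open>of_real 1\<close> brings the left side into the two-dilation
    form of \<open>avg\<close>.\<close>
  have "(\<integral>z. f (of_real (\<rho>\<^sup>2) * z) * cnj (k (of_real 1 * z)) * W z \<partial>lborel)
       = (\<integral>z. f (of_real \<rho> * z) * cnj (k (of_real \<rho> * z)) * W z \<partial>lborel)"
    using int1
    apply (subst integral_rotation_average, simp)
    apply (subst integral_rotation_average[OF int2])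
    apply (simp only: avg)
    using circle_integral_cnj_mult[OF holomorphic_on_UNIV_mult_arg[OF k] holomorphic_on_UNIV_mult_arg[OF f] \<rho>]
    by (simp add: mult_ac)
  thus ?thesis by simp
qed

text \<open>A monomial detects a single Taylor coefficient of \<open>k\<close>, multiplied by a
  moment of the weight; \<open>S_pos\<close> finds in this way a test function on which the
  functional does not vanish.\<close>

lemma integral_power_cnj:
  assumes k: "k holomorphic_on UNIV"
    and rad: "\<And>c z. cmod c = 1 \<Longrightarrow> W (c * z) = W z"
    and int1: "integrable lborel (\<lambda>z. z ^ n * cnj (k z) * W z)"
  shows "(\<integral>z. z ^ n * cnj (k z) * W z \<partial>lborel)
       = (\<integral>z. of_real (cmod z ^ (2 * n)) * W z \<partial>lborel) * cnj ((deriv ^^ n) k 0 / fact n)"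
proof -
  have ck: "continuous_on A k" for A
    using k holomorphic_on_imp_continuous_on continuous_on_subset by blast
  have avg: "(\<integral>t. indicator {0..1} t *\<^sub>R ((cis (2 * pi * t) * z) ^ n * cnj (k (cis (2 * pi * t) * z)) * W (cis (2 * pi * t) * z)) \<partial>lborel)
     = of_real (cmod z ^ (2 * n)) * W z * cnj ((deriv ^^ n) k 0 / fact n)" for z
  proof -
    have "set_integrable lborel {0..1} (\<lambda>t. (cis (2 * pi * t) * z) ^ n * cnj (k (cis (2 * pi * t) * z)))"
      by (intro borel_integrable_atLeastAtMost' continuous_on_mult continuous_on_cnj
         continuous_on_compose2[OF ck[of UNIV]]) (auto intro!: continuous_intros)
    from set_borel_integral_eq_integral(2)[OF this] show ?thesis
      by (simp add: set_lebesgue_integral_def rad circle_integral_power_cnj[OF k] flip: scaleR_scaleR mult_scaleR_left)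
  qed
  show ?thesis
    by (subst integral_rotation_average[OF int1]) (simp only: avg integral_mult_left_zero)
qed

lemma Holder_weighted:
  fixes u v w :: "'a \<Rightarrow> real"
  assumes p: "p > 1" and q: "q = p / (p - 1)"
    and [measurable]: "u \<in> borel_measurable M" "v \<in> borel_measurable M" "w \<in> borel_measurable M"
    and nonneg: "\<And>x. 0 \<le> u x" "\<And>x. 0 \<le> v x" "\<And>x. 0 \<le> w x"
    and iu: "integrable M (\<lambda>x. u x powr p * w x)" and iv: "integrable M (\<lambda>x. v x powr q * w x)"
  shows "integrable M (\<lambda>x. u x * v x * w x)"
    and "(\<integral>x. u x * v x * w x \<partial>M) \<le> (\<integral>x. u x powr p * w x \<partial>M) powr (1 / p) * (\<integral>x. v x powr q * w x \<partial>M) powr (1 / q)"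
proof -
  have pq: "q > 1" "1 / p + 1 / q = 1" using p unfolding q by (auto simp: field_simps)
  have young: "u x * v x * w x \<le> u x powr p * w x / p + v x powr q * w x / q" for x
    using mult_right_mono[OF Youngs_inequality[OF p pq, of "u x" "v x"], of "w x"] nonneg
    by (simp add: algebra_simps)
  show int: "integrable M (\<lambda>x. u x * v x * w x)"
    by (rule Bochner_Integration.integrable_bound[of _ "\<lambda>x. u x powr p * w x / p + v x powr q * w x / q"])
       (use iu iv young nonneg p pq in \<open>auto intro!: add_nonneg_nonneg mult_nonneg_nonneg divide_nonneg_nonneg\<close>)
  define U where "U = (\<integral>x. u x powr p * w x \<partial>M)"
  define V where "V = (\<integral>x. v x powr q * w x \<partial>M)"
  have UV: "U \<ge> 0" "V \<ge> 0" unfolding U_def V_def using nonneg by (auto intro!: integral_nonneg)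
  have "(\<integral>x. u x * v x * w x \<partial>M) \<le> U powr (1 / p) * V powr (1 / q)"
  \<comment> \<open>Normalising by \<open>a\<close> and \<open>b\<close> requires both integrals to
    be positive; if one vanishes, its integrand and hence the product is zero almost
    everywhere.\<close>
  proof (cases "U = 0 \<or> V = 0")
    case True
    have "AE x in M. u x powr p * w x = 0 \<or> v x powr q * w x = 0"
    proof (cases "U = 0")
      case True
      hence "AE x in M. u x powr p * w x = 0"
        using integral_nonneg_eq_0_iff_AE[OF iu] nonneg by (auto simp: U_def)
      thus ?thesis by eventually_elim auto
    next
      case False
      hence "AE x in M. v x powr q * w x = 0"
        using integral_nonneg_eq_0_iff_AE[OF iv] nonneg \<open>U = 0 \<or> V = 0\<close> by (auto simp: V_def)
      thus ?thesis by eventually_elim auto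
    qed
    hence "AE x in M. u x * v x * w x = 0" by eventually_elim auto
    hence "(\<integral>x. u x * v x * w x \<partial>M) = 0"
      by (rule integral_eq_zero_AE)
    thus ?thesis by simp
  next
    case False
    hence pos: "U > 0" "V > 0" using UV by auto
    define a where "a = U powr (1 / p)"
    define b where "b = V powr (1 / q)"
    have ab: "a > 0" "b > 0" "a powr p = U" "b powr q = V"
      using pos p pq by (auto simp: a_def b_def powr_powr)
    have y: "u x * v x * w x \<le> a * b * (u x powr p * w x / (p * U) + v x powr q * w x / (q * V))" for x
    proof -
      have "u x / a * (v x / b) \<le> (u x / a) powr p / p + (v x / b) powr q / q"
        using nonneg ab by (intro Youngs_inequality[OF p pq]) auto
      also have "\<dots> = u x powr p / (p * U) + v x powr q / (q * V)"
        using nonneg ab by (simp add: powr_divide mult.commute)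
      finally have "u x / a * (v x / b) * (a * b * w x) \<le> (u x powr p / (p * U) + v x powr q / (q * V)) * (a * b * w x)"
        using ab nonneg by (intro mult_right_mono) auto
      thus ?thesis using ab by (simp add: algebra_simps)
    qed
    have "(\<integral>x. u x * v x * w x \<partial>M) \<le> (\<integral>x. a * b * (u x powr p * w x / (p * U) + v x powr q * w x / (q * V)) \<partial>M)"
      using iu iv y by (intro integral_mono int) auto
    also have "\<dots> = a * b * (U / (p * U) + V / (q * V))"
      using iu iv by (simp add: U_def V_def)
    also have "\<dots> = a * b" using pos pq by simp
    finally show ?thesis by (simp add: a_def b_def)
  qed
  thus "(\<integral>x. u x * v x * w x \<partial>M) \<le> (\<integral>x. u x powr p * w x \<partial>M) powr (1 / p) * (\<integral>x. v x powr q * w x \<partial>M) powr (1 / q)"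
    by (simp add: U_def V_def)
qed

text \<open>The derivative of \<open>\<omega>\<close> is the real part of that of the holomorphic
  extension. Openness of its domain makes the derivative two-sided even at 0.\<close>

lemma analytic_near_halfline_deriv:
  assumes "analytic_near_halfline \<omega>"
  shows "\<And>x. x \<ge> 0 \<Longrightarrow> (\<omega> has_real_derivative deriv \<omega> x) (at x)"
    and "continuous_on {0..} (deriv \<omega>)"
proof -
  obtain U W where U: "open U" "complex_of_real ` {0..} \<subseteq> U" and W: "W holomorphic_on U"
    and eq: "\<And>x. complex_of_real x \<in> U \<Longrightarrow> W (complex_of_real x) = complex_of_real (\<omega> x)"
    using assms unfolding analytic_near_halfline_def by blast
  have der: "(\<omega> has_real_derivative Re (deriv W (of_real x))) (at x)" if "x \<ge> 0" for x
  proof -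
    have "(W has_field_derivative deriv W (of_real x)) (at (of_real x))"
      using that U by (intro holomorphic_derivI[OF W]) auto
    hence "((\<lambda>x. Re (W (of_real x))) has_real_derivative Re (deriv W (of_real x))) (at x)"
      by (intro has_field_derivative_Re has_vector_derivative_real_field)
    thus ?thesis
    proof (rule has_field_derivative_transform_within_open)
      show "open (complex_of_real -` U)" using U by (intro open_vimage continuous_intros) auto
    qed (use that U eq in auto)
  qed
  have d: "deriv \<omega> x = Re (deriv W (of_real x))" if "x \<ge> 0" for x
    using DERIV_imp_deriv[OF der[OF that]] .
  show "(\<omega> has_real_derivative deriv \<omega> x) (at x)" if "x \<ge> 0" for x
    using der d that by simp
  have "continuous_on U (deriv W)"
    using W U by (intro holomorphic_on_imp_continuous_on holomorphic_deriv)
  hence "continuous_on {0..} (\<lambda>x. Re (deriv W (of_real x)))"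
    using U(2) by (intro continuous_on_Re continuous_on_compose2[of U "deriv W" _ complex_of_real]) (auto intro: continuous_intros)
  thus "continuous_on {0..} (deriv \<omega>)"
    using d by (subst continuous_on_cong[OF refl, where g = "\<lambda>x. Re (deriv W (of_real x))"]) auto
qed

section \<open>Increments of a radial weight\<close>

locale radial_weight =
  fixes \<omega> :: "real \<Rightarrow> real"
  assumes DERIV_omega: "\<And>x. x \<ge> 0 \<Longrightarrow> (\<omega> has_real_derivative deriv \<omega> x) (at x)"
    and cont_deriv_omega: "continuous_on {0..} (deriv \<omega>)"
    and omega_pos: "\<And>x. x \<ge> 0 \<Longrightarrow> \<omega> x > 0"
    and omega_antimono: "\<And>x y. 0 \<le> x \<Longrightarrow> x \<le> y \<Longrightarrow> \<omega> y \<le> \<omega> x"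
begin

definition \<nu> :: "complex \<Rightarrow> real" where "\<nu> z = \<omega> ((cmod z)\<^sup>2)"

text \<open>Minus half of |z| d/d|z| applied to \<open>\<nu>\<close>; it is the weight in
  \<open>D_integrand\<close>.\<close>

definition \<kappa> :: "complex \<Rightarrow> real" where "\<kappa> z = - ((cmod z)\<^sup>2 * deriv \<omega> ((cmod z)\<^sup>2))"

lemma nu_pos: "\<nu> z > 0"
  by (simp add: \<nu>_def omega_pos)

lemma nu_mult_unit: "cmod c = 1 \<Longrightarrow> \<nu> (c * z) = \<nu> z"
  by (simp add: \<nu>_def norm_mult)

lemma kappa_mult_unit: "cmod c = 1 \<Longrightarrow> \<kappa> (c * z) = \<kappa> z"
  by (simp add: \<kappa>_def norm_mult)

lemma nu_antimono: "cmod w \<le> cmod z \<Longrightarrow> \<nu> z \<le> \<nu> w"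
  by (simp add: \<nu>_def omega_antimono power_mono)

lemma nu_divide_le: "0 < s \<Longrightarrow> s \<le> t \<Longrightarrow> \<nu> (z / of_real s) \<le> \<nu> (z / of_real t)"
  by (rule nu_antimono) (simp add: norm_divide frac_le)

lemma nu_divide_le_self: "0 < s \<Longrightarrow> s \<le> 1 \<Longrightarrow> \<nu> (z / of_real s) \<le> \<nu> z"
  using nu_divide_le[of s 1 z] by simp

lemma deriv_omega_nonpos:
  assumes "x \<ge> 0"
  shows "deriv \<omega> x \<le> 0"
proof (rule ccontr)
  assume "\<not> deriv \<omega> x \<le> 0"
  then obtain d where "d > 0" "\<forall>h>0. h < d \<longrightarrow> \<omega> x < \<omega> (x + h)"
    using DERIV_pos_inc_right[OF DERIV_omega[OF assms]] by force
  hence "\<omega> x < \<omega> (x + d / 2)" by simp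
  thus False using omega_antimono[of x "x + d / 2"] assms \<open>d > 0\<close> by simp
qed

lemma kappa_nonneg: "\<kappa> z \<ge> 0"
  using deriv_omega_nonpos[of "(cmod z)\<^sup>2"] by (simp add: \<kappa>_def mult_le_0_iff)

lemma borel_measurable_nu [measurable]: "\<nu> \<in> borel_measurable borel"
proof -
  have "continuous_on {0..} \<omega>"
    by (rule DERIV_continuous_on[where D = "deriv \<omega>"]) (auto intro: DERIV_omega has_field_derivative_at_within)
  hence "continuous_on UNIV (\<lambda>z. \<omega> ((cmod z)\<^sup>2))"
    by (rule continuous_on_compose2) (auto intro!: continuous_intros)
  thus ?thesis unfolding \<nu>_def by (rule borel_measurable_continuous_onI)
qed

lemma borel_measurable_kappa [measurable]: "\<kappa> \<in> borel_measurable borel"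
proof -
  have "continuous_on UNIV (\<lambda>z. deriv \<omega> ((cmod z)\<^sup>2))"
    by (rule continuous_on_compose2[OF cont_deriv_omega]) (auto intro!: continuous_intros)
  thus ?thesis unfolding \<kappa>_def by (intro borel_measurable_continuous_onI continuous_intros)
qed

lemma DERIV_nu_divide:
  assumes "t > 0"
  shows "((\<lambda>t. \<nu> (w / of_real t)) has_real_derivative 2 / t * \<kappa> (w / of_real t)) (at t)"
proof -
  have "((\<lambda>t. \<omega> ((cmod w)\<^sup>2 / t\<^sup>2)) has_real_derivative
      deriv \<omega> ((cmod w)\<^sup>2 / t\<^sup>2) * (- 2 * (cmod w)\<^sup>2 / t ^ 3)) (at t)"
    by (rule DERIV_chain2[OF DERIV_omega])
       (use assms in \<open>auto intro!: derivative_eq_intros simp: field_simps power2_eq_square power3_eq_cube power4_eq_xxxx\<close>)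
  also have "(\<lambda>t. \<omega> ((cmod w)\<^sup>2 / t\<^sup>2)) = (\<lambda>t. \<nu> (w / of_real t))"
    by (simp add: \<nu>_def norm_divide power_divide)
  also have "deriv \<omega> ((cmod w)\<^sup>2 / t\<^sup>2) * (- 2 * (cmod w)\<^sup>2 / t ^ 3) = 2 / t * \<kappa> (w / of_real t)"
    by (simp add: \<kappa>_def norm_divide power_divide power2_eq_square power3_eq_cube mult_ac)
  finally show ?thesis .
qed

text \<open>The fundamental theorem of calculus in the dilation parameter, phrased with a
  nonnegative integral so that Tonelli can exchange it with the plane integral.\<close>

lemma nu_increment_eq_nn_integral:
  assumes "0 < s" "s \<le> 1"
  shows "ennreal (\<nu> w - \<nu> (w / of_real s)) =
    (\<integral>\<^sup>+t. ennreal (2 / t * \<kappa> (w / of_real t)) * indicator {s..1} t \<partial>lborel)"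
  using assms DERIV_nu_divide
  by (subst nn_integral_FTC_Icc[of "\<lambda>t. 2 / t * \<kappa> (w / of_real t)" s 1 "\<lambda>t. \<nu> (w / of_real t)"])
     (simp_all add: kappa_nonneg)

text \<open>After Tonelli, the substitution w = t u frees \<open>\<kappa>\<close> from its dilation
  at the cost of t^2, and \<open>nn_integral_dilate_mono\<close> removes the dilation from
  \<open>g\<close>. What remains is the integral of (2/t) t^2 = 2t over \<open>{s..1}\<close>, that
  is 1 - s^2.\<close>

lemma nn_integral_nu_increment_le:
  assumes g: "g holomorphic_on UNIV" and p: "p > 1" and s: "0 < s" "s \<le> 1"
  shows "(\<integral>\<^sup>+w. ennreal (cmod (g w) powr p * (\<nu> w - \<nu> (w / of_real s))) \<partial>lborel)
    \<le> ennreal (1 - s\<^sup>2) * (\<integral>\<^sup>+w. ennreal (cmod (g w) powr p * \<kappa> w) \<partial>lborel)"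
proof -
  have [measurable]: "g \<in> borel_measurable borel"
    by (rule borel_measurable_holomorphic_UNIV[OF g])
  define D where "D = (\<integral>\<^sup>+w. ennreal (cmod (g w) powr p * \<kappa> w) \<partial>lborel)"
  have "(\<integral>\<^sup>+w. ennreal (cmod (g w) powr p * (\<nu> w - \<nu> (w / of_real s))) \<partial>lborel) =
     (\<integral>\<^sup>+w. \<integral>\<^sup>+t. ennreal (cmod (g w) powr p) * (ennreal (2 / t * \<kappa> (w / of_real t)) * indicator {s..1} t) \<partial>lborel \<partial>lborel)"
    using s by (intro nn_integral_cong) (simp add: ennreal_mult' nu_increment_eq_nn_integral nn_integral_cmult)
  also have "\<dots> = (\<integral>\<^sup>+t. \<integral>\<^sup>+w. ennreal (cmod (g w) powr p) * (ennreal (2 / t * \<kappa> (w / of_real t)) * indicator {s..1} t) \<partial>lborel \<partial>lborel)"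
    by (rule lborel_pair.Fubini') (simp add: split_beta')
  also have "\<dots> \<le> (\<integral>\<^sup>+t. ennreal (2 * t) * indicator {s..1} t * D \<partial>lborel)"
  proof (rule nn_integral_mono)
    fix t :: real
    show "(\<integral>\<^sup>+w. ennreal (cmod (g w) powr p) * (ennreal (2 / t * \<kappa> (w / of_real t)) * indicator {s..1} t) \<partial>lborel)
       \<le> ennreal (2 * t) * indicator {s..1} t * D"
    proof (cases "t \<in> {s..1}")
      case True
      hence t: "0 < t" "t \<le> 1" using s by auto
      have split: "ennreal (2 / t * \<kappa> w) = ennreal (2 / t) * ennreal (\<kappa> w)" for w
        using t by (intro ennreal_mult') auto
      have "(\<integral>\<^sup>+w. ennreal (cmod (g w) powr p) * (ennreal (2 / t * \<kappa> (w / of_real t)) * indicator {s..1} t) \<partial>lborel)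
        = (\<integral>\<^sup>+w. ennreal (2 / t) * (ennreal (cmod (g w) powr p) * ennreal (\<kappa> (w / of_real t))) \<partial>lborel)"
        using True by (intro nn_integral_cong) (simp only: split indicator_simps mult_1_right mult_1_left mult_ac)
      also have "\<dots> = ennreal (2 / t) * (\<integral>\<^sup>+w. ennreal (cmod (g w) powr p) * ennreal (\<kappa> (w / of_real t)) \<partial>lborel)"
        by (rule nn_integral_cmult) measurable
      also have "(\<integral>\<^sup>+w. ennreal (cmod (g w) powr p) * ennreal (\<kappa> (w / of_real t)) \<partial>lborel)
        = ennreal (t\<^sup>2) * (\<integral>\<^sup>+u. ennreal (cmod (g (of_real t * u)) powr p) * ennreal (\<kappa> u) \<partial>lborel)"
        using t by (subst nn_integral_lborel_dilate[OF _ t(1)]) auto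
      also have "ennreal (2 / t) * \<dots> = ennreal (2 * t) * (\<integral>\<^sup>+u. ennreal (cmod (g (of_real t * u)) powr p) * ennreal (\<kappa> u) \<partial>lborel)"
        using t by (simp add: mult.assoc[symmetric] ennreal_mult[symmetric] power2_eq_square)
      also have "\<dots> \<le> ennreal (2 * t) * (\<integral>\<^sup>+u. ennreal (cmod (g u) powr p) * ennreal (\<kappa> u) \<partial>lborel)"
        using t by (intro mult_left_mono nn_integral_dilate_mono[OF g p]) (auto simp: kappa_mult_unit)
      also have "\<dots> = ennreal (2 * t) * indicator {s..1} t * D"
        using True by (simp add: D_def ennreal_mult')
      finally show ?thesis .
    qed simp
  qed
  also have "\<dots> = (\<integral>\<^sup>+t. ennreal (2 * t) * indicator {s..1} t \<partial>lborel) * D"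
    by (rule nn_integral_multc) measurable
  also have "(\<integral>\<^sup>+t. ennreal (2 * t) * indicator {s..1} t \<partial>lborel) = ennreal (1\<^sup>2 - s\<^sup>2)"
    using s by (intro nn_integral_FTC_Icc) (auto intro!: derivative_eq_intros)
  finally show ?thesis by (simp add: D_def)
qed

lemma nn_integral_nu_divide:
  assumes [measurable]: "g \<in> borel_measurable borel" and s: "s > 0"
  shows "(\<integral>\<^sup>+w. ennreal (cmod (g w) powr p * \<nu> (w / of_real s)) \<partial>lborel) =
    ennreal (s\<^sup>2) * (\<integral>\<^sup>+u. ennreal (cmod (g (of_real s * u)) powr p * \<nu> u) \<partial>lborel)"
  using s by (subst nn_integral_lborel_dilate[OF _ s]) auto

lemma nn_integral_nu_dilate_mono:
  assumes g: "g holomorphic_on UNIV" and p: "p > 1" and s: "0 \<le> s" "s \<le> 1"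
  shows "(\<integral>\<^sup>+u. ennreal (cmod (g (of_real s * u)) powr p * \<nu> u) \<partial>lborel)
    \<le> (\<integral>\<^sup>+u. ennreal (cmod (g u) powr p * \<nu> u) \<partial>lborel)"
  using nn_integral_dilate_mono[OF g p s, of "\<lambda>z. ennreal (\<nu> z)"] by (simp add: nu_mult_unit ennreal_mult')

text \<open>Fatou's lemma: the difference quotients of the weight are nonnegative and converge
  pointwise to \<open>2 * \<kappa> w\<close>.\<close>

lemma nn_integral_kappa_le_liminf:
  assumes [measurable]: "g \<in> borel_measurable borel"
    and r: "\<And>n. 0 < r n" "\<And>n. r n < 1" "r \<longlonglongrightarrow> 1"
  shows "2 * (\<integral>\<^sup>+w. ennreal (cmod (g w) powr p * \<kappa> w) \<partial>lborel)
     \<le> liminf (\<lambda>n. \<integral>\<^sup>+w. ennreal (cmod (g w) powr p * (\<nu> w - \<nu> (w / of_real (r n))) / (1 - r n)) \<partial>lborel)"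
proof -
  have lim: "(\<lambda>n. ennreal (cmod (g w) powr p * (\<nu> w - \<nu> (w / of_real (r n))) / (1 - r n)))
      \<longlonglongrightarrow> ennreal (2 * (cmod (g w) powr p * \<kappa> w))" for w
  proof -
    have "((\<lambda>t. (\<nu> (w / of_real t) - \<nu> (w / of_real 1)) / (t - 1)) \<longlongrightarrow> 2 / 1 * \<kappa> (w / of_real 1)) (at 1)"
      using DERIV_nu_divide[of 1 w] by (simp add: has_field_derivative_iff)
    moreover have "filterlim r (at 1) sequentially"
      using r(2,3) by (intro filterlim_atI) (auto intro!: always_eventually simp: less_imp_neq)
    ultimately have "(\<lambda>n. (\<nu> (w / of_real (r n)) - \<nu> (w / of_real 1)) / (r n - 1)) \<longlonglongrightarrow> 2 / 1 * \<kappa> (w / of_real 1)"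
      by (rule filterlim_compose)
    hence "(\<lambda>n. cmod (g w) powr p * ((\<nu> (w / of_real (r n)) - \<nu> (w / of_real 1)) / (r n - 1)))
        \<longlonglongrightarrow> cmod (g w) powr p * (2 / 1 * \<kappa> (w / of_real 1))"
      by (rule tendsto_mult_left)
    moreover have "cmod (g w) powr p * ((\<nu> (w / of_real (r n)) - \<nu> (w / of_real 1)) / (r n - 1))
       = cmod (g w) powr p * (\<nu> w - \<nu> (w / of_real (r n))) / (1 - r n)" for n
      using minus_divide_divide[of "\<nu> w - \<nu> (w / of_real (r n))" "1 - r n"] by simp
    ultimately show ?thesis by (intro tendsto_ennrealI) (simp add: mult_ac)
  qed
  have "2 * (\<integral>\<^sup>+w. ennreal (cmod (g w) powr p * \<kappa> w) \<partial>lborel) = (\<integral>\<^sup>+w. ennreal (2 * (cmod (g w) powr p * \<kappa> w)) \<partial>lborel)"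
    by (subst nn_integral_cmult[symmetric]) (auto simp: ennreal_mult' ennreal_numeral)
  also have "\<dots> = (\<integral>\<^sup>+w. liminf (\<lambda>n. ennreal (cmod (g w) powr p * (\<nu> w - \<nu> (w / of_real (r n))) / (1 - r n))) \<partial>lborel)"
    by (intro nn_integral_cong lim_imp_Liminf[OF _ lim, symmetric]) auto
  also have "\<dots> \<le> liminf (\<lambda>n. \<integral>\<^sup>+w. ennreal (cmod (g w) powr p * (\<nu> w - \<nu> (w / of_real (r n))) / (1 - r n)) \<partial>lborel)"
    by (rule nn_integral_liminf) measurable
  finally show ?thesis .
qed

end

section \<open>Weighted spaces of entire functions\<close>

lemma borel_measurable_cnj [measurable]: "cnj \<in> borel_measurable borel"
  by (intro borel_measurable_continuous_onI continuous_intros)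

lemma borel_measurable_complex_of_real [measurable]: "complex_of_real \<in> borel_measurable borel"
  by (intro borel_measurable_continuous_onI continuous_intros)

context radial_weight
begin

lemma Ap_spaceD:
  assumes "g \<in> Ap_space p \<nu>"
  shows "g holomorphic_on UNIV" "g \<in> borel_measurable borel"
    and "integrable lborel (\<lambda>z. cmod (g z) powr p * \<nu> z)"
  using assms by (auto simp: Ap_space_def borel_measurable_holomorphic_UNIV)

lemma Phi_bound:
  assumes p: "p > 1" and q: "q = p / (p - 1)" and g: "g \<in> Ap_space p \<nu>" and k: "k \<in> Ap_space q \<nu>"
  shows "integrable lborel (\<lambda>z. g z * cnj (k z) * of_real (\<nu> z))"
    and "cmod (Phi \<nu> k g) \<le> Ap_norm p \<nu> g * Ap_norm q \<nu> k"
proof -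
  note [measurable] = Ap_spaceD(2)[OF g] Ap_spaceD(2)[OF k]
  note H = Holder_weighted[OF p q, where M = lborel and u = "\<lambda>z. cmod (g z)" and v = "\<lambda>z. cmod (k z)" and w = \<nu>]
  have eq: "norm (g z * cnj (k z) * of_real (\<nu> z)) = cmod (g z) * cmod (k z) * \<nu> z" for z
    using nu_pos[of z] by (simp add: norm_mult)
  have "integrable lborel (\<lambda>z. cmod (g z) * cmod (k z) * \<nu> z)"
    by (rule H(1)) (use Ap_spaceD(3)[OF g] Ap_spaceD(3)[OF k] in \<open>auto simp: nu_pos less_imp_le\<close>)
  thus "integrable lborel (\<lambda>z. g z * cnj (k z) * of_real (\<nu> z))"
    by (subst integrable_norm_iff[symmetric]) (simp_all only: eq, measurable)
  have "cmod (Phi \<nu> k g) \<le> (\<integral>z. cmod (g z) * cmod (k z) * \<nu> z \<partial>lborel)"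
    unfolding Phi_def by (rule order_trans[OF integral_norm_bound]) (simp only: eq order_refl)
  also have "\<dots> \<le> Ap_norm p \<nu> g * Ap_norm q \<nu> k"
    unfolding Ap_norm_def
    by (rule H(2)) (use Ap_spaceD(3)[OF g] Ap_spaceD(3)[OF k] in \<open>auto simp: nu_pos less_imp_le\<close>)
  finally show "cmod (Phi \<nu> k g) \<le> Ap_norm p \<nu> g * Ap_norm q \<nu> k" .
qed

lemma Ap_norm_nonneg: "Ap_norm p \<nu> g \<ge> 0"
  by (simp add: Ap_norm_def)

lemma Ap_space_cmult:
  assumes g: "g \<in> Ap_space p \<nu>" and p: "p > 0"
  shows "(\<lambda>z. c * g z) \<in> Ap_space p \<nu>" and "Ap_norm p \<nu> (\<lambda>z. c * g z) = cmod c * Ap_norm p \<nu> g"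
proof -
  have eq: "cmod (c * g z) powr p * \<nu> z = cmod c powr p * (cmod (g z) powr p * \<nu> z)" for z
    by (simp add: norm_mult powr_mult mult_ac)
  show "(\<lambda>z. c * g z) \<in> Ap_space p \<nu>"
    unfolding Ap_space_def mem_Collect_eq eq using Ap_spaceD[OF g] by (auto intro!: holomorphic_intros)
  show "Ap_norm p \<nu> (\<lambda>z. c * g z) = cmod c * Ap_norm p \<nu> g"
    unfolding Ap_norm_def eq using p
    by (simp add: powr_mult powr_powr Bochner_Integration.integral_nonneg nu_pos less_imp_le)
qed

lemma Phi_cmult: "Phi \<nu> k (\<lambda>z. c * g z) = c * Phi \<nu> k g"
  unfolding Phi_def by (simp add: mult.assoc)

text \<open>Makes dilates admissible in the extremal problem; finiteness comes from the monotonicity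
  of circular means.\<close>

lemma Ap_space_dilate:
  assumes g: "g \<in> Ap_space p \<nu>" and p: "p > 1" and s: "0 \<le> s" "s \<le> 1"
  shows "(\<lambda>z. g (of_real s * z)) \<in> Ap_space p \<nu>"
proof -
  note [measurable] = Ap_spaceD(2)[OF g]
  have "(\<integral>\<^sup>+u. ennreal (cmod (g (of_real s * u)) powr p * \<nu> u) \<partial>lborel)
      \<le> (\<integral>\<^sup>+u. ennreal (cmod (g u) powr p * \<nu> u) \<partial>lborel)"
    by (rule nn_integral_nu_dilate_mono[OF Ap_spaceD(1)[OF g] p s])
  also have "\<dots> < \<infinity>"
    using Ap_spaceD(3)[OF g] by (simp add: integrable_iff_bounded nu_pos less_imp_le abs_mult)
  finally have "integrable lborel (\<lambda>z. cmod (g (of_real s * z)) powr p * \<nu> z)"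
    by (intro integrableI_bounded) (auto simp: nu_pos less_imp_le abs_mult)
  thus ?thesis
    using holomorphic_on_UNIV_mult_arg[OF Ap_spaceD(1)[OF g]] by (simp add: Ap_space_def)
qed

text \<open>The quantities A(s) and B(s) of the outline, for \<open>f\<close> with exponent
  \<open>p\<close> and for \<open>k\<close> with exponent \<open>q\<close>.\<close>

definition nu_increment :: "real \<Rightarrow> (complex \<Rightarrow> complex) \<Rightarrow> real \<Rightarrow> real" where
  "nu_increment p g s = (\<integral>w. cmod (g w) powr p * (\<nu> w - \<nu> (w / of_real s)) \<partial>lborel)"

section \<open>Increments of the weight against a fixed function of the space\<close>

context
  fixes p :: real and g :: "complex \<Rightarrow> complex"
  assumes p: "p > 1" and g: "g \<in> Ap_space p \<nu>"
begin

lemma integrable_nu_divide: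
  assumes s: "0 < s" "s \<le> 1"
  shows "integrable lborel (\<lambda>w. cmod (g w) powr p * \<nu> (w / of_real s))"
proof -
  note [measurable] = Ap_spaceD(2)[OF g]
  show ?thesis
    by (rule Bochner_Integration.integrable_bound[OF Ap_spaceD(3)[OF g]])
       (auto simp: abs_mult nu_pos less_imp_le intro!: mult_left_mono nu_divide_le_self s)
qed

lemma integrable_nu_increment:
  assumes s: "0 < s" "s \<le> 1"
  shows "integrable lborel (\<lambda>w. cmod (g w) powr p * (\<nu> w - \<nu> (w / of_real s)))"
  using Bochner_Integration.integrable_diff[OF Ap_spaceD(3)[OF g] integrable_nu_divide[OF s]] by (simp add: right_diff_distrib)

lemma nu_increment_nonneg:
  assumes "0 < s" "s \<le> 1"
  shows "nu_increment p g s \<ge> 0"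
  unfolding nu_increment_def using assms by (intro Bochner_Integration.integral_nonneg) (auto simp: nu_divide_le_self)

lemma nn_integral_nu_increment:
  assumes s: "0 < s" "s \<le> 1"
  shows "(\<integral>\<^sup>+w. ennreal (cmod (g w) powr p * (\<nu> w - \<nu> (w / of_real s))) \<partial>lborel) = ennreal (nu_increment p g s)"
  unfolding nu_increment_def
  by (rule nn_integral_eq_integral[OF integrable_nu_increment[OF s]]) (auto simp: nu_divide_le_self s)

lemma integral_nu_divide:
  assumes s: "0 < s" "s \<le> 1"
  shows "(\<integral>w. cmod (g w) powr p * \<nu> (w / of_real s) \<partial>lborel) =
    (\<integral>w. cmod (g w) powr p * \<nu> w \<partial>lborel) - nu_increment p g s"
  unfolding nu_increment_def right_diff_distrib
  by (subst Bochner_Integration.integral_diff[OF Ap_spaceD(3)[OF g] integrable_nu_divide[OF s]]) simp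

text \<open>Substituting w = s u converts the norm of a dilate into an increment of the weight; this
  brings \<open>nu_increment\<close> into the left side of the extremal inequality.\<close>

lemma integral_dilate_nu:
  assumes s: "0 < s" "s \<le> 1"
  shows "s\<^sup>2 * (\<integral>u. cmod (g (of_real s * u)) powr p * \<nu> u \<partial>lborel)
    = (\<integral>w. cmod (g w) powr p * \<nu> w \<partial>lborel) - nu_increment p g s"
proof -
  have "integrable lborel (\<lambda>u. cmod (g (of_real s * u)) powr p * \<nu> u)"
    using Ap_spaceD(3)[OF Ap_space_dilate[OF g p, of s]] s by simp
  hence 1: "(\<integral>\<^sup>+u. ennreal (cmod (g (of_real s * u)) powr p * \<nu> u) \<partial>lborel) =
      ennreal (\<integral>u. cmod (g (of_real s * u)) powr p * \<nu> u \<partial>lborel)"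
    by (rule nn_integral_eq_integral) (auto simp: nu_pos less_imp_le)
  have 2: "(\<integral>\<^sup>+u. ennreal (cmod (g u) powr p * \<nu> (u / of_real s)) \<partial>lborel) =
      ennreal (\<integral>u. cmod (g u) powr p * \<nu> (u / of_real s) \<partial>lborel)"
    by (rule nn_integral_eq_integral[OF integrable_nu_divide[OF s]]) (auto simp: nu_pos less_imp_le)
  have "ennreal (s\<^sup>2 * (\<integral>u. cmod (g (of_real s * u)) powr p * \<nu> u \<partial>lborel)) =
     ennreal (\<integral>u. cmod (g u) powr p * \<nu> (u / of_real s) \<partial>lborel)"
    using nn_integral_nu_divide[OF Ap_spaceD(2)[OF g] s(1), of p] unfolding 1 2
    by (simp add: ennreal_mult')
  thus ?thesis
    unfolding integral_nu_divide[OF s, symmetric]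
    by (subst (asm) ennreal_inj) (auto intro!: Bochner_Integration.integral_nonneg mult_nonneg_nonneg simp: nu_pos less_imp_le)
qed

text \<open>The dilate has the smaller integral. Combined with \<open>nu_increment_le\<close> at a
  single \<open>s\<close>, this bounds the integral against \<open>\<kappa>\<close> from
  below.\<close>

lemma nu_increment_ge:
  assumes s: "0 < s" "s \<le> 1"
  shows "(1 - s\<^sup>2) * (\<integral>w. cmod (g w) powr p * \<nu> w \<partial>lborel) \<le> nu_increment p g s"
proof -
  have int: "integrable lborel (\<lambda>u. cmod (g (of_real s * u)) powr p * \<nu> u)"
    using Ap_spaceD(3)[OF Ap_space_dilate[OF g p, of s]] s by simp
  have "ennreal (\<integral>u. cmod (g (of_real s * u)) powr p * \<nu> u \<partial>lborel) \<le> ennreal (\<integral>u. cmod (g u) powr p * \<nu> u \<partial>lborel)"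
    using nn_integral_nu_dilate_mono[OF Ap_spaceD(1)[OF g] p, of s] s
    by (subst (asm) (1 2) nn_integral_eq_integral) (auto simp: int Ap_spaceD(3)[OF g] nu_pos less_imp_le)
  hence "(\<integral>u. cmod (g (of_real s * u)) powr p * \<nu> u \<partial>lborel) \<le> (\<integral>u. cmod (g u) powr p * \<nu> u \<partial>lborel)"
    by (subst (asm) ennreal_le_iff) (auto intro!: Bochner_Integration.integral_nonneg simp: nu_pos less_imp_le)
  hence "s\<^sup>2 * (\<integral>u. cmod (g (of_real s * u)) powr p * \<nu> u \<partial>lborel) \<le> s\<^sup>2 * (\<integral>u. cmod (g u) powr p * \<nu> u \<partial>lborel)"
    by (intro mult_left_mono) auto
  thus ?thesis unfolding integral_dilate_nu[OF s] by (simp add: algebra_simps)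
qed

lemma nu_increment_antimono:
  assumes "0 < s" "s \<le> t" "t \<le> 1"
  shows "nu_increment p g t \<le> nu_increment p g s"
  unfolding nu_increment_def using assms
  by (intro Bochner_Integration.integral_mono integrable_nu_increment) (auto intro!: mult_left_mono nu_divide_le)

lemma nu_increment_le:
  assumes s: "0 < s" "s \<le> 1" and int: "integrable lborel (\<lambda>w. cmod (g w) powr p * \<kappa> w)"
  shows "nu_increment p g s \<le> (1 - s\<^sup>2) * (\<integral>w. cmod (g w) powr p * \<kappa> w \<partial>lborel)"
proof -
  have nn: "0 \<le> (\<integral>w. cmod (g w) powr p * \<kappa> w \<partial>lborel)"
    by (intro Bochner_Integration.integral_nonneg) (auto simp: kappa_nonneg)
  have s2: "0 \<le> 1 - s\<^sup>2" using s by (simp add: power_le_one)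
  have "ennreal (nu_increment p g s) \<le> ennreal (1 - s\<^sup>2) * ennreal (\<integral>w. cmod (g w) powr p * \<kappa> w \<partial>lborel)"
    using nn_integral_nu_increment_le[OF Ap_spaceD(1)[OF g] p s]
    unfolding nn_integral_nu_increment[OF s]
    by (subst (asm) nn_integral_eq_integral[OF int]) (auto simp: kappa_nonneg)
  also have "\<dots> = ennreal ((1 - s\<^sup>2) * (\<integral>w. cmod (g w) powr p * \<kappa> w \<partial>lborel))"
    using nn s2 by (simp add: ennreal_mult)
  finally show ?thesis
    by (subst (asm) ennreal_le_iff) (use nn s2 in auto)
qed

text \<open>Fatou's bound in the form in which it is used twice: first a constant \<open>y\<close>
  yields integrability, then a sharper convergent \<open>y\<close> yields the estimate.\<close>

lemma kappa_integral_le_limit: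
  assumes r: "\<And>n. 0 < r n" "\<And>n. r n < 1" "r \<longlonglongrightarrow> 1"
    and y: "\<And>n. nu_increment p g (r n) / (1 - r n) \<le> y n" "y \<longlonglongrightarrow> Y"
  shows "integrable lborel (\<lambda>w. cmod (g w) powr p * \<kappa> w)"
    and "2 * (\<integral>w. cmod (g w) powr p * \<kappa> w \<partial>lborel) \<le> Y"
proof -
  note [measurable] = Ap_spaceD(2)[OF g]
  have "0 \<le> y n" for n
    using order_trans[OF divide_nonneg_nonneg y(1)[of n]] nu_increment_nonneg[of "r n"] r(1,2)[of n] by simp
  hence Y: "0 \<le> Y" using y(2) by (intro LIMSEQ_le_const[OF y(2)]) auto
  have eq: "(\<integral>\<^sup>+w. ennreal (cmod (g w) powr p * (\<nu> w - \<nu> (w / of_real (r n))) / (1 - r n)) \<partial>lborel)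
      = ennreal (nu_increment p g (r n) / (1 - r n))" for n
    using r(1,2)[of n] integrable_nu_increment[of "r n"]
    by (subst nn_integral_eq_integral) (auto simp: nu_increment_def nu_divide_le_self)
  have "2 * (\<integral>\<^sup>+w. ennreal (cmod (g w) powr p * \<kappa> w) \<partial>lborel)
     \<le> liminf (\<lambda>n. ennreal (nu_increment p g (r n) / (1 - r n)))"
    using nn_integral_kappa_le_liminf[OF Ap_spaceD(2)[OF g] r, of p] unfolding eq .
  also have "\<dots> \<le> liminf (\<lambda>n. ennreal (y n))"
    by (intro Liminf_mono always_eventually allI ennreal_leI y)
  also have "\<dots> = ennreal Y"
    by (intro lim_imp_Liminf tendsto_ennrealI y) auto
  finally have le: "2 * (\<integral>\<^sup>+w. ennreal (cmod (g w) powr p * \<kappa> w) \<partial>lborel) \<le> ennreal Y" .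
  have "(\<integral>\<^sup>+w. ennreal (cmod (g w) powr p * \<kappa> w) \<partial>lborel) < \<infinity>"
  proof (rule ccontr)
    assume "\<not> ?thesis"
    hence "(\<integral>\<^sup>+w. ennreal (cmod (g w) powr p * \<kappa> w) \<partial>lborel) = \<infinity>" by (simp add: not_less top_unique)
    thus False using le by (simp add: ennreal_mult_top top_unique)
  qed
  thus int: "integrable lborel (\<lambda>w. cmod (g w) powr p * \<kappa> w)"
    by (intro integrableI_bounded) (auto simp: kappa_nonneg abs_mult)
  have "ennreal (2 * (\<integral>w. cmod (g w) powr p * \<kappa> w \<partial>lborel)) \<le> ennreal Y"
    using le by (subst (asm) nn_integral_eq_integral[OF int]) (auto simp: kappa_nonneg ennreal_mult')
  thus "2 * (\<integral>w. cmod (g w) powr p * \<kappa> w \<partial>lborel) \<le> Y"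
    using Y by (subst (asm) ennreal_le_iff) auto
qed

end

end

section \<open>The extremal problem\<close>

text \<open>A product of two one-dimensional Cauchy kernels, serving as an integrable majorant on
  the plane that needs no polar coordinates.\<close>

lemma integrable_inverse_square_decay:
  "integrable lborel (\<lambda>z. inverse ((1 + (Re z)\<^sup>2) * (1 + (Im z)\<^sup>2)))"
proof (rule integrableI_bounded)
  have [measurable]: "Re \<in> borel_measurable borel" "Im \<in> borel_measurable borel"
    by (intro borel_measurable_continuous_onI continuous_intros)+
  show "(\<lambda>z. inverse ((1 + (Re z)\<^sup>2) * (1 + (Im z)\<^sup>2))) \<in> borel_measurable lborel"
    by measurable
  have "integrable lborel (\<lambda>x::real. inverse (1 + x\<^sup>2))"
    using integrable_inverse_1_plus_square by (simp add: set_integrable_def)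
  hence fin: "(\<integral>\<^sup>+x. ennreal (inverse (1 + (x::real)\<^sup>2)) \<partial>lborel) < \<infinity>"
    by (simp add: integrable_iff_bounded)
  have "(\<integral>\<^sup>+z. ennreal (norm (inverse ((1 + (Re z)\<^sup>2) * (1 + (Im z)\<^sup>2)))) \<partial>lborel)
     = (\<integral>\<^sup>+x. \<integral>\<^sup>+y. ennreal (inverse (1 + x\<^sup>2)) * ennreal (inverse (1 + y\<^sup>2)) \<partial>lborel \<partial>lborel)"
    by (subst nn_integral_lborel_complex(1)) (auto simp: abs_mult ennreal_mult')
  also have "\<dots> = (\<integral>\<^sup>+x. ennreal (inverse (1 + (x::real)\<^sup>2)) \<partial>lborel) * (\<integral>\<^sup>+x. ennreal (inverse (1 + (x::real)\<^sup>2)) \<partial>lborel)"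
    by (simp add: nn_integral_cmult nn_integral_multc)
  also have "\<dots> < \<infinity>" using fin by (simp add: ennreal_mult_less_top)
  finally show "(\<integral>\<^sup>+z. ennreal (norm (inverse ((1 + (Re z)\<^sup>2) * (1 + (Im z)\<^sup>2)))) \<partial>lborel) < \<infinity>" .
qed

context radial_weight
begin

text \<open>The weight decays faster than any power, so |z|^(np) times the weight times (1 +
  |z|^2)^2 is bounded; since (1 + x^2)(1 + y^2) <= (1 + |z|^2)^2, the majorant of
  \<open>integrable_inverse_square_decay\<close> applies.\<close>

lemma power_in_Ap_space:
  assumes lim: "\<forall>n::int. ((\<lambda>r. r powi n * \<omega> (r\<^sup>2)) \<longlongrightarrow> 0) at_top" and p: "p > 0"
  shows "(\<lambda>z. z ^ n) \<in> Ap_space p \<nu>"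
proof -
  \<comment> \<open>The exponent \<open>n * p\<close> pays for the power, and 4 for the factor (1 +
    |z|^2)^2.\<close>
  define N where "N = nat \<lceil>real n * p\<rceil> + 4"
  have N: "real n * p + 4 \<le> real N" unfolding N_def using p by linarith
  have "((\<lambda>r. r powi int N * \<omega> (r\<^sup>2)) \<longlongrightarrow> 0) at_top" using lim by blast
  hence "eventually (\<lambda>r. r powi int N * \<omega> (r\<^sup>2) < 1) at_top"
    by (rule order_tendstoD) simp
  then obtain R0 where R0: "\<And>r. r \<ge> R0 \<Longrightarrow> r ^ N * \<omega> (r\<^sup>2) < 1"
    by (auto simp: eventually_at_top_linorder)
  define R where "R = max 1 R0"
  \<comment> \<open>The summand 4 covers |z| >= R, where (1 + a^2)^2 <= 4 a^4 and the decay bound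
    holds; the other covers |z| < R, where the weight is at most \<open>\<omega> 0\<close>.\<close>
  define C where "C = 4 + (R ^ n) powr p * \<omega> 0 * (1 + R\<^sup>2)\<^sup>2"
  have C0: "0 \<le> (R ^ n) powr p * \<omega> 0 * (1 + R\<^sup>2)\<^sup>2" using omega_pos[of 0] by simp
  have bound: "cmod (z ^ n) powr p * \<nu> z * (1 + (cmod z)\<^sup>2)\<^sup>2 \<le> C" for z
  proof (cases "cmod z \<ge> R")
    case True
    define a where "a = cmod z"
    have a: "a \<ge> 1" "a \<ge> R0" using True by (auto simp: a_def R_def)
    have "1 + a\<^sup>2 \<le> 2 * a\<^sup>2" using a one_le_power[of a 2] by simp
    hence "(1 + a\<^sup>2)\<^sup>2 \<le> (2 * a\<^sup>2)\<^sup>2" using a by (intro power_mono) auto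
    also have "\<dots> = 4 * a powr 4" using a by (simp add: power_mult_distrib flip: power_mult)
    finally have 1: "(1 + a\<^sup>2)\<^sup>2 \<le> 4 * a powr 4" .
    have "cmod (z ^ n) = a powr real n"
      using a powr_realpow[of a n] by (simp add: norm_power flip: a_def)
    hence "cmod (z ^ n) powr p * \<nu> z * (1 + (cmod z)\<^sup>2)\<^sup>2 \<le> a powr (real n * p) * \<nu> z * (4 * a powr 4)"
      using 1 nu_pos[of z] by (auto simp: powr_powr simp flip: a_def intro!: mult_left_mono)
    also have "\<dots> = 4 * (a powr (real n * p + 4) * \<nu> z)" by (simp only: powr_add mult_ac)
    also have "\<dots> \<le> 4 * (a powr real N * \<nu> z)"
      using N a nu_pos[of z] by (intro mult_left_mono mult_right_mono powr_mono) auto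
    also have "\<dots> = 4 * (a ^ N * \<omega> (a\<^sup>2))" using a powr_realpow[of a N] by (simp add: \<nu>_def flip: a_def)
    also have "\<dots> \<le> 4" using R0[OF a(2)] by simp
    finally show ?thesis using C0 by (simp add: C_def)
  next
    case False
    have "cmod (z ^ n) powr p * \<nu> z * (1 + (cmod z)\<^sup>2)\<^sup>2 \<le> (R ^ n) powr p * \<omega> 0 * (1 + R\<^sup>2)\<^sup>2"
      using False p nu_pos[of z] omega_pos[of 0]
      by (intro mult_mono powr_mono2 power_mono)
         (auto simp: norm_power \<nu>_def less_imp_le intro!: power_mono omega_antimono)
    thus ?thesis by (simp add: C_def)
  qed
  have "integrable lborel (\<lambda>z. cmod (z ^ n) powr p * \<nu> z)"
  proof (rule Bochner_Integration.integrable_bound[OF integrable_mult_right[OF integrable_inverse_square_decay, of C]])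
    show "(\<lambda>z. cmod (z ^ n) powr p * \<nu> z) \<in> borel_measurable lborel" by measurable
    show "AE z in lborel. norm (cmod (z ^ n) powr p * \<nu> z) \<le> norm (C * inverse ((1 + (Re z)\<^sup>2) * (1 + (Im z)\<^sup>2)))"
    proof (rule AE_I2)
      fix z
      have C: "C \<ge> 0" using C0 by (simp add: C_def)
      have pos: "0 < (1 + (Re z)\<^sup>2) * (1 + (Im z)\<^sup>2)" by (intro mult_pos_pos add_pos_nonneg) auto
      have "(1 + (Re z)\<^sup>2) * (1 + (Im z)\<^sup>2) \<le> (1 + (cmod z)\<^sup>2) * (1 + (cmod z)\<^sup>2)"
        by (intro mult_mono) (auto simp: cmod_power2)
      hence "cmod (z ^ n) powr p * \<nu> z * ((1 + (Re z)\<^sup>2) * (1 + (Im z)\<^sup>2)) \<le> cmod (z ^ n) powr p * \<nu> z * (1 + (cmod z)\<^sup>2)\<^sup>2"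
        using nu_pos[of z] unfolding power2_eq_square[of "1 + (cmod z)\<^sup>2"] by (intro mult_left_mono) auto
      also have "\<dots> \<le> C" by (rule bound)
      finally have "cmod (z ^ n) powr p * \<nu> z \<le> C / ((1 + (Re z)\<^sup>2) * (1 + (Im z)\<^sup>2))"
        using pos by (simp add: pos_le_divide_eq)
      thus "norm (cmod (z ^ n) powr p * \<nu> z) \<le> norm (C * inverse ((1 + (Re z)\<^sup>2) * (1 + (Im z)\<^sup>2)))"
        using nu_pos[of z] C pos by (simp only: real_norm_def abs_mult abs_inverse) (simp add: divide_inverse)
    qed
  qed
  thus ?thesis by (auto simp: Ap_space_def intro!: holomorphic_intros)
qed

end

section \<open>The extremal value as an operator norm\<close>

locale radial_extremal = radial_weight +
  fixes p q :: real and k f :: "complex \<Rightarrow> complex"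
  assumes p: "p > 1" and q: "q = p / (p - 1)"
    and k: "k \<in> Ap_space q \<nu>" and f: "is_extremal p \<nu> k f"
begin

definition S :: real where "S = Re (Phi \<nu> k f)"

lemma q_gt_1: "q > 1" and conjugate: "1 / p + 1 / q = 1"
  using p unfolding q by (auto simp: field_simps)

lemma f_space: "f \<in> Ap_space p \<nu>" and f_norm: "Ap_norm p \<nu> f = 1"
  using f by (auto simp: is_extremal_def)

text \<open>Scale \<open>g\<close> to norm 1, where the supremum applies. Hoelder's inequality
  provides the boundedness without which \<open>Sup\<close> need not be an upper bound, and it
  settles the case of norm 0.\<close>

lemma Re_Phi_le:
  assumes g: "g \<in> Ap_space p \<nu>"
  shows "Re (Phi \<nu> k g) \<le> S * Ap_norm p \<nu> g"
proof (cases "Ap_norm p \<nu> g = 0")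
  case True
  thus ?thesis using Phi_bound(2)[OF p q g k] complex_Re_le_cmod[of "Phi \<nu> k g"] by simp
next
  case False
  define N where "N = Ap_norm p \<nu> g"
  have N: "N > 0" using False Ap_norm_nonneg[of p g] by (simp add: N_def)
  define h where "h = (\<lambda>z. of_real (inverse N) * g z)"
  have h: "h \<in> Ap_space p \<nu>" "Ap_norm p \<nu> h = 1"
    unfolding h_def using Ap_space_cmult[OF g, of "of_real (inverse N)"] p N
    by (auto simp: norm_inverse simp flip: N_def)
  have "Re (Phi \<nu> k h) \<le> Sup {Re (Phi \<nu> k g) | g. g \<in> Ap_space p \<nu> \<and> Ap_norm p \<nu> g = 1}"
  proof (rule cSup_upper)
    show "bdd_above {Re (Phi \<nu> k g) | g. g \<in> Ap_space p \<nu> \<and> Ap_norm p \<nu> g = 1}"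
    proof (rule bdd_aboveI)
      fix x assume "x \<in> {Re (Phi \<nu> k g) | g. g \<in> Ap_space p \<nu> \<and> Ap_norm p \<nu> g = 1}"
      then obtain g where x: "x = Re (Phi \<nu> k g)" "g \<in> Ap_space p \<nu>" "Ap_norm p \<nu> g = 1" by auto
      show "x \<le> Ap_norm q \<nu> k"
        using Phi_bound(2)[OF p q x(2) k] complex_Re_le_cmod[of "Phi \<nu> k g"] x by simp
    qed
  qed (use h in auto)
  also have "\<dots> = S" using f by (simp add: is_extremal_def S_def)
  also have "Re (Phi \<nu> k h) = Re (Phi \<nu> k g) / N"
    unfolding h_def Phi_cmult by (simp add: divide_inverse_commute del: of_real_inverse)
  finally show ?thesis using N by (simp add: pos_divide_le_eq flip: N_def)
qed

text \<open>Testing with the negative of \<open>f\<close> gives -S <= S.\<close>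

lemma S_nonneg: "S \<ge> 0"
proof -
  have "Re (Phi \<nu> k (\<lambda>z. - 1 * f z)) \<le> S * Ap_norm p \<nu> (\<lambda>z. - 1 * f z)"
    by (intro Re_Phi_le Ap_space_cmult f_space) (use p in auto)
  also have "\<dots> = S"
    using p by (subst Ap_space_cmult(2)[OF f_space]) (auto simp: f_norm)
  finally show ?thesis by (subst (asm) Phi_cmult) (simp add: S_def)
qed

text \<open>A factor \<open>c\<close> of modulus at most 1 (it is 0 when the functional vanishes at
  \<open>g\<close>) makes the functional real and nonnegative, so the bound on real parts
  suffices.\<close>

lemma norm_Phi_le:
  assumes g: "g \<in> Ap_space p \<nu>"
  shows "cmod (Phi \<nu> k g) \<le> S * Ap_norm p \<nu> g"
proof -
  define c where "c = cnj (sgn (Phi \<nu> k g))"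
  have "c * Phi \<nu> k g = of_real (cmod (Phi \<nu> k g))"
    using complex_norm_square[of "Phi \<nu> k g"]
    by (cases "Phi \<nu> k g = 0") (simp_all add: c_def sgn_eq power2_eq_square field_simps)
  hence "cmod (Phi \<nu> k g) = Re (Phi \<nu> k (\<lambda>z. c * g z))" by (simp add: Phi_cmult)
  also have "\<dots> \<le> S * Ap_norm p \<nu> (\<lambda>z. c * g z)"
    by (intro Re_Phi_le Ap_space_cmult g) (use p in auto)
  also have "Ap_norm p \<nu> (\<lambda>z. c * g z) = cmod c * Ap_norm p \<nu> g"
    using p by (intro Ap_space_cmult(2) g) auto
  also have "S * (cmod c * Ap_norm p \<nu> g) \<le> S * (1 * Ap_norm p \<nu> g)"
    by (intro mult_left_mono mult_right_mono S_nonneg Ap_norm_nonneg) (auto simp: c_def norm_sgn)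
  finally show ?thesis by simp
qed

lemma dual_norm_eq: "dual_norm p \<nu> k = S"
  unfolding dual_norm_def
proof (rule cSup_eq_maximum)
  have "cmod (Phi \<nu> k f) = S"
    using norm_Phi_le[OF f_space] complex_Re_le_cmod[of "Phi \<nu> k f"] by (simp add: f_norm S_def)
  thus "S \<in> {cmod (Phi \<nu> k g) | g. g \<in> Ap_space p \<nu> \<and> Ap_norm p \<nu> g \<le> 1}"
    using f_space f_norm by (intro CollectI exI[of _ f]) auto
next
  fix x assume "x \<in> {cmod (Phi \<nu> k g) | g. g \<in> Ap_space p \<nu> \<and> Ap_norm p \<nu> g \<le> 1}"
  then obtain g where g: "x = cmod (Phi \<nu> k g)" "g \<in> Ap_space p \<nu>" "Ap_norm p \<nu> g \<le> 1" by auto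
  show "x \<le> S"
    using norm_Phi_le[OF g(2)] mult_left_mono[OF g(3) S_nonneg] g(1) by simp
qed

text \<open>Some Taylor coefficient of \<open>k\<close> at 0 is nonzero. On the corresponding power
  of \<open>z\<close> the functional is the conjugate of that coefficient times a moment of a
  positive weight, so it cannot vanish.\<close>

lemma S_pos:
  assumes lim: "\<forall>n::int. ((\<lambda>r. r powi n * \<omega> (r\<^sup>2)) \<longlongrightarrow> 0) at_top"
    and knz: "k \<noteq> (\<lambda>z. 0)"
  shows "S > 0"
proof (rule ccontr)
  assume "\<not> S > 0"
  hence S0: "S = 0" using S_nonneg by simp
  obtain n where n: "(deriv ^^ n) k 0 \<noteq> 0"
    using knz holomorphic_fun_eq_0_on_connected[OF Ap_spaceD(1)[OF k], of 0] by auto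
  have zn: "(\<lambda>z. z ^ n) \<in> Ap_space p \<nu>" using p by (intro power_in_Ap_space lim) auto
  have "Phi \<nu> k (\<lambda>z. z ^ n) = 0" using norm_Phi_le[OF zn] by (simp add: S0)
  moreover have "Phi \<nu> k (\<lambda>z. z ^ n) =
      (\<integral>z. of_real (cmod z ^ (2 * n)) * of_real (\<nu> z) \<partial>lborel) * cnj ((deriv ^^ n) k 0 / fact n)"
    unfolding Phi_def
    by (rule integral_power_cnj[OF Ap_spaceD(1)[OF k] _ Phi_bound(1)[OF p q zn k]])
       (simp add: nu_mult_unit)
  moreover have "(\<integral>z. of_real (cmod z ^ (2 * n)) * of_real (\<nu> z) \<partial>lborel)
     = complex_of_real (\<integral>z. cmod z ^ (2 * n) * \<nu> z \<partial>lborel)"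
    by (simp only: integral_complex_of_real flip: of_real_mult)
  ultimately have 0: "(\<integral>z. cmod z ^ (2 * n) * \<nu> z \<partial>lborel) = 0" using n by simp
  \<comment> \<open>The exponent 2 is auxiliary: membership of \<open>z ^ n\<close> in that space is
    integrability of the moment integrand.\<close>
  have "integrable lborel (\<lambda>z. cmod (z ^ n) powr 2 * \<nu> z)"
    by (rule Ap_spaceD(3)[OF power_in_Ap_space[OF lim]]) simp
  also have "(\<lambda>z. cmod (z ^ n) powr 2 * \<nu> z) = (\<lambda>z. cmod z ^ (2 * n) * \<nu> z)"
    by (simp add: norm_power powr_numeral flip: power_mult) (simp add: mult.commute)
  finally have int: "integrable lborel (\<lambda>z. cmod z ^ (2 * n) * \<nu> z)" .
  have "AE z in lborel. cmod z ^ (2 * n) * \<nu> z = 0"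
    using integral_nonneg_eq_0_iff_AE[OF int] 0 by (simp add: nu_pos less_imp_le)
  moreover have "AE z in (lborel :: complex measure). z \<noteq> 0" by (rule AE_lborel_singleton)
  ultimately have "AE z in (lborel :: complex measure). False"
    by eventually_elim (auto simp: nu_pos[THEN less_imp_neq, symmetric])
  thus False by (simp add: AE_iff_null null_sets_def)
qed

lemma integral_f_eq_1: "(\<integral>z. cmod (f z) powr p * \<nu> z \<partial>lborel) = 1"
proof -
  define I where "I = (\<integral>z. cmod (f z) powr p * \<nu> z \<partial>lborel)"
  have "I powr (1 / p) = 1" using f_norm by (simp add: Ap_norm_def I_def)
  hence "(I powr (1 / p)) powr p = 1" by simp
  moreover have "I \<ge> 0" unfolding I_def
    by (intro Bochner_Integration.integral_nonneg) (auto simp: nu_pos less_imp_le)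
  ultimately have "I = 1" using p by (simp add: powr_powr)
  thus ?thesis by (simp add: I_def)
qed

text \<open>The dilate of \<open>f\<close> competes in the extremal problem, and by orthogonality of powers on circles the
  dilation can be shared equally between \<open>f\<close> and \<open>k\<close>, where a substitution moves it to the weight.\<close>

lemma extremal_dilation_bound:
  assumes \<rho>: "0 < \<rho>" "\<rho> \<le> 1"
  shows "S * (1 - \<rho>\<^sup>2 * Ap_norm p \<nu> (\<lambda>z. f (of_real (\<rho>\<^sup>2) * z)))
    \<le> nu_increment p f \<rho> powr (1 / p) * nu_increment q k \<rho> powr (1 / q)"
proof -
  have \<rho>2: "0 \<le> \<rho>\<^sup>2" "\<rho>\<^sup>2 \<le> 1" using \<rho> by (auto simp: power_le_one)
  note [measurable] = Ap_spaceD(2)[OF f_space] Ap_spaceD(2)[OF k]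
  \<comment> \<open>The dilation factor r of the outline is \<open>\<rho>\<^sup>2\<close> here, so
    that its square root is \<open>\<rho>\<close>.\<close>
  define fr where "fr = (\<lambda>z. f (of_real (\<rho>\<^sup>2) * z))"
  have fr: "fr \<in> Ap_space p \<nu>" unfolding fr_def by (rule Ap_space_dilate[OF f_space p \<rho>2])
  have f\<rho>: "(\<lambda>z. f (of_real \<rho> * z)) \<in> Ap_space p \<nu>" using \<rho> by (intro Ap_space_dilate[OF f_space p]) auto
  have k\<rho>: "(\<lambda>z. k (of_real \<rho> * z)) \<in> Ap_space q \<nu>" using \<rho> by (intro Ap_space_dilate[OF k q_gt_1]) auto
  define \<Delta> where "\<Delta> w = \<nu> w - \<nu> (w / of_real \<rho>)" for w
  have \<Delta>: "\<Delta> w \<ge> 0" for w using \<rho> by (simp add: \<Delta>_def nu_divide_le_self)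
  have [measurable]: "\<Delta> \<in> borel_measurable borel" unfolding \<Delta>_def by measurable
  have int0: "integrable lborel (\<lambda>z. f z * cnj (k z) * of_real (\<nu> z))"
    by (rule Phi_bound(1)[OF p q f_space k])
  have int1: "integrable lborel (\<lambda>z. f z * cnj (k z) * of_real (\<nu> (z / of_real \<rho>)))"
    by (rule Bochner_Integration.integrable_bound[OF int0])
       (use \<rho> in \<open>auto simp: norm_mult nu_pos less_imp_le intro!: mult_left_mono nu_divide_le_self\<close>)
  have "Phi \<nu> k fr = (\<integral>z. f (of_real \<rho> * z) * cnj (k (of_real \<rho> * z)) * of_real (\<nu> z) \<partial>lborel)"
    unfolding Phi_def fr_def
    by (rule integral_cnj_mult_dilate[OF Ap_spaceD(1)[OF k] Ap_spaceD(1)[OF f_space] \<rho>])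
       (use Phi_bound(1)[OF p q fr k] Phi_bound(1)[OF p q f\<rho> k\<rho>] in \<open>simp_all add: nu_mult_unit fr_def\<close>)
  \<comment> \<open>The factor \<open>\<rho>\<^sup>2\<close> is exactly the Jacobian of w = \<rho>
    z.\<close>
  hence "of_real (\<rho>\<^sup>2) * Phi \<nu> k fr = (\<integral>z. f z * cnj (k z) * of_real (\<nu> (z / of_real \<rho>)) \<partial>lborel)"
    using \<rho> by (subst integral_lborel_dilate[OF _ \<rho>(1)]) simp_all
  hence eq: "Phi \<nu> k f - of_real (\<rho>\<^sup>2) * Phi \<nu> k fr = (\<integral>z. f z * cnj (k z) * of_real (\<Delta> z) \<partial>lborel)"
    using Bochner_Integration.integral_diff[OF int0 int1] by (simp add: Phi_def \<Delta>_def algebra_simps)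
  have "Re (Phi \<nu> k f - of_real (\<rho>\<^sup>2) * Phi \<nu> k fr) \<le> cmod (\<integral>z. f z * cnj (k z) * of_real (\<Delta> z) \<partial>lborel)"
    unfolding eq by (rule complex_Re_le_cmod)
  also have "cmod (\<integral>z. f z * cnj (k z) * of_real (\<Delta> z) \<partial>lborel) \<le> (\<integral>z. cmod (f z) * cmod (k z) * \<Delta> z \<partial>lborel)"
    by (rule order_trans[OF integral_norm_bound]) (simp add: norm_mult \<Delta>)
  also have "\<dots> \<le> nu_increment p f \<rho> powr (1 / p) * nu_increment q k \<rho> powr (1 / q)"
    unfolding nu_increment_def \<Delta>_def[symmetric]
    by (rule Holder_weighted(2)[OF p q])
       (use integrable_nu_increment[OF p f_space \<rho>] integrable_nu_increment[OF q_gt_1 k \<rho>] \<Delta> in \<open>auto simp: \<Delta>_def\<close>)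
  finally have "Re (Phi \<nu> k f - of_real (\<rho>\<^sup>2) * Phi \<nu> k fr)
      \<le> nu_increment p f \<rho> powr (1 / p) * nu_increment q k \<rho> powr (1 / q)" .
  moreover have "Re (Phi \<nu> k f - of_real (\<rho>\<^sup>2) * Phi \<nu> k fr) = S - \<rho>\<^sup>2 * Re (Phi \<nu> k fr)"
    by (simp add: S_def del: of_real_power)
  moreover have "\<rho>\<^sup>2 * Re (Phi \<nu> k fr) \<le> \<rho>\<^sup>2 * (S * Ap_norm p \<nu> fr)"
    by (intro mult_left_mono Re_Phi_le fr) auto
  ultimately show ?thesis by (simp add: fr_def algebra_simps)
qed

end

section \<open>Passage to the limit\<close>

lemma powr_difference_quotient_at_1:
  fixes \<theta> :: real
  assumes r: "\<And>n. r n < 1" "r \<longlonglongrightarrow> 1"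
  shows "(\<lambda>n. (1 - r n powr \<theta>) / (1 - r n)) \<longlonglongrightarrow> \<theta>"
proof -
  have "((\<lambda>x::real. x powr \<theta>) has_real_derivative \<theta> * 1 powr (\<theta> - 1)) (at 1)"
    by (rule has_real_derivative_powr) simp
  hence "((\<lambda>x. (x powr \<theta> - 1) / (x - 1)) \<longlongrightarrow> \<theta>) (at 1)"
    by (simp add: has_field_derivative_iff)
  moreover have "filterlim r (at 1) sequentially"
    using r by (intro filterlim_atI) (auto intro!: always_eventually simp: less_imp_neq)
  ultimately have "(\<lambda>n. (r n powr \<theta> - 1) / (r n - 1)) \<longlonglongrightarrow> \<theta>"
    by (rule filterlim_compose)
  moreover have "(r n powr \<theta> - 1) / (r n - 1) = (1 - r n powr \<theta>) / (1 - r n)" for n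
    using minus_divide_divide[of "1 - r n powr \<theta>" "1 - r n"] by simp
  ultimately show ?thesis by simp
qed

text \<open>An a priori bound: the right side grows only like x^(1/p). For x > 1 the summand 1 is
  absorbed into x^(1/p), and dividing by that power leaves x^(1/q) <= 2K.\<close>

lemma le_of_le_mult_one_plus_powr:
  fixes x K p q :: real
  assumes "1 < p" "q = p / (p - 1)" "0 \<le> x" "0 \<le> K" "x \<le> K * (1 + x powr (1 / p))"
  shows "x \<le> 1 + (2 * K) powr q"
proof (cases "x \<le> 1")
  case False
  have q: "0 < q" "1 / p + 1 / q = 1" using assms(1) unfolding assms(2) by (auto simp: field_simps)
  have "1 \<le> x powr (1 / p)" using False assms by (intro ge_one_powr_ge_zero) auto
  hence "K * (1 + x powr (1 / p)) \<le> K * (2 * x powr (1 / p))"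
    using assms by (intro mult_left_mono) auto
  with assms have le: "x \<le> 2 * K * x powr (1 / p)" by simp
  have "x = x powr (1 / p + 1 / q)" using False q by simp
  also have "\<dots> = x powr (1 / p) * x powr (1 / q)" by (rule powr_add)
  finally have "x powr (1 / p) * x powr (1 / q) \<le> x powr (1 / p) * (2 * K)" using le by (simp add: mult_ac)
  hence "x powr (1 / q) \<le> 2 * K" using False by (simp add: mult_le_cancel_left)
  hence "(x powr (1 / q)) powr q \<le> (2 * K) powr q" using q by (intro powr_mono2) auto
  thus ?thesis using q False by (simp add: powr_powr)
qed (auto intro: order_trans)

section \<open>From the dilation inequality to the integral against \<kappa>\<close>

context radial_extremal
begin

text \<open>\<open>extremal_dilation_bound\<close> at \<rho> = \<open>sqrt r\<close>, divided by
  \<open>1 - r\<close>. The increment at \<open>r\<close> comes from the norm of the dilate, the one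
  at \<open>sqrt r\<close> from sharing the dilation between \<open>f\<close> and
  \<open>k\<close>.\<close>

lemma extremal_increment_bound:
  assumes r: "0 < r" "r < 1" and intk: "integrable lborel (\<lambda>w. cmod (k w) powr q * \<kappa> w)"
  shows "S * ((1 - r powr (1 - 2 / p)) / (1 - r) + r powr (1 - 2 / p) * (nu_increment p f r / (1 - r)) / p)
    \<le> (\<integral>w. cmod (k w) powr q * \<kappa> w \<partial>lborel) powr (1 / q) * (nu_increment p f (sqrt r) / (1 - r)) powr (1 / p)"
proof -
  define \<theta> where "\<theta> = 1 - 2 / p"
  define A where "A = nu_increment p f r"
  define A' where "A' = nu_increment p f (sqrt r)"
  define M where "M = (\<integral>w. cmod (k w) powr q * \<kappa> w \<partial>lborel)"
  have s: "0 < sqrt r" "sqrt r \<le> 1" "(sqrt r)\<^sup>2 = r" using r by auto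
  have A0: "0 \<le> A" "0 \<le> A'" unfolding A_def A'_def
    using r s by (auto intro!: nu_increment_nonneg[OF p f_space])
  have M0: "0 \<le> M" unfolding M_def
    by (intro Bochner_Integration.integral_nonneg) (auto simp: kappa_nonneg)
  define I where "I = (\<integral>u. cmod (f (of_real r * u)) powr p * \<nu> u \<partial>lborel)"
  have I: "r\<^sup>2 * I = 1 - A"
    unfolding I_def A_def using integral_dilate_nu[OF p f_space, of r] r by (simp add: integral_f_eq_1)
  have I0: "0 \<le> I" unfolding I_def
    by (intro Bochner_Integration.integral_nonneg) (auto simp: nu_pos less_imp_le)
  have A1: "0 \<le> 1 - A" using I I0 by (metis mult_nonneg_nonneg zero_le_power2)
  have "I = (1 - A) * r powr (- 2)" using I r by (simp add: powr_minus powr_numeral field_simps)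
  hence "r * I powr (1 / p) = r * ((1 - A) powr (1 / p) * r powr (- 2 / p))"
    using A1 by (simp add: powr_mult powr_powr)
  also have "\<dots> = r powr \<theta> * (1 - A) powr (1 / p)"
    using r by (simp add: \<theta>_def powr_diff powr_minus divide_inverse)
  also have "\<dots> \<le> r powr \<theta> * (1 - A / p)"
  proof (intro mult_left_mono)
    \<comment> \<open>Bernoulli's inequality, obtained from Young's with second factor 1;
      \<open>A = 1\<close> is treated apart because Young's inequality is used here for positive
      numbers.\<close>
    show "(1 - A) powr (1 / p) \<le> 1 - A / p"
    proof (cases "A = 1")
      case False
      hence "(1 - A) powr (1 / p) * 1 powr (1 - 1 / p) \<le> 1 / p * (1 - A) + (1 - 1 / p) * 1"
        using A1 p by (intro Youngs_inequality_0) auto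
      thus ?thesis by (simp add: algebra_simps diff_divide_distrib)
    qed (use p in auto)
  qed auto
  finally have fr: "r * I powr (1 / p) \<le> r powr \<theta> * (1 - A / p)" .
  have B: "nu_increment q k (sqrt r) \<le> (1 - r) * M"
    using nu_increment_le[OF q_gt_1 k s(1,2) intk] s by (simp add: M_def)
  have "S * (1 - r powr \<theta> * (1 - A / p)) \<le> S * (1 - r * I powr (1 / p))"
    using fr S_nonneg by (intro mult_left_mono) auto
  also have "\<dots> \<le> A' powr (1 / p) * nu_increment q k (sqrt r) powr (1 / q)"
    using extremal_dilation_bound[OF s(1,2)] s(3) by (simp add: Ap_norm_def I_def A'_def)
  also have "\<dots> \<le> A' powr (1 / p) * ((1 - r) * M) powr (1 / q)"
    using B q_gt_1 nu_increment_nonneg[OF q_gt_1 k s(1,2)] by (intro mult_left_mono powr_mono2) auto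
  finally have main: "S * (1 - r powr \<theta> * (1 - A / p)) \<le> A' powr (1 / p) * ((1 - r) * M) powr (1 / q)" .
  \<comment> \<open>One factor cancels the power of \<open>1 - r\<close> gained from
    \<open>k\<close>; the other moves inside the power of \<open>A'\<close>.\<close>
  have split: "1 - r = (1 - r) powr (1 / p) * (1 - r) powr (1 / q)"
    using r conjugate by (simp flip: powr_add)
  have "S * ((1 - r powr \<theta>) / (1 - r) + r powr \<theta> * (A / (1 - r)) / p) = S * (1 - r powr \<theta> * (1 - A / p)) / (1 - r)"
    using r by (simp add: algebra_simps add_divide_distrib diff_divide_distrib)
  also have "\<dots> \<le> A' powr (1 / p) * ((1 - r) * M) powr (1 / q) / (1 - r)"
    using main r by (intro divide_right_mono) auto
  also have "\<dots> = A' powr (1 / p) * ((1 - r) powr (1 / q) * M powr (1 / q)) / ((1 - r) powr (1 / p) * (1 - r) powr (1 / q))"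
    using r M0 split by (simp add: powr_mult)
  also have "\<dots> = M powr (1 / q) * (A' / (1 - r)) powr (1 / p)"
    using r A0 by (simp add: powr_divide)
  finally show ?thesis by (simp add: \<theta>_def A_def A'_def M_def)
qed

text \<open>The same inequality \<open>x_le\<close> is used twice. Taking \<open>t = x n\<close>
  bounds \<open>x n\<close>, whence integrability; once \<open>D\<close> is known to be finite,
  \<open>t = D\<close> gives the sharp estimate in the limit.\<close>

lemma extremal_kappa_bound:
  assumes S: "S > 0" and intk: "integrable lborel (\<lambda>w. cmod (k w) powr q * \<kappa> w)"
  defines "D \<equiv> (\<integral>w. cmod (f w) powr p * \<kappa> w \<partial>lborel)"
    and "M \<equiv> (\<integral>w. cmod (k w) powr q * \<kappa> w \<partial>lborel) powr (1 / q)"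
  shows "integrable lborel (\<lambda>w. cmod (f w) powr p * \<kappa> w)"
    and "2 * D + (p - 2) \<le> p * (M / S) * D powr (1 / p)"
proof -
  define \<theta> where "\<theta> = 1 - 2 / p"
  \<comment> \<open>Any sequence in (0,1) tending to 1 would serve; the shift by 2 keeps
    \<open>r 0\<close> positive.\<close>
  define r where "r n = 1 - 1 / real (n + 2)" for n
  have r: "0 < r n" "r n < 1" for n by (auto simp: r_def field_simps)
  have rlim: "r \<longlonglongrightarrow> 1"
  proof -
    have "(\<lambda>n. 1 / real (n + 2)) \<longlonglongrightarrow> 0"
      using LIMSEQ_ignore_initial_segment[OF lim_1_over_n, of 2] by simp
    hence "(\<lambda>n. 1 - 1 / real (n + 2)) \<longlonglongrightarrow> 1 - 0" by (intro tendsto_intros)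
    thus ?thesis by (simp add: r_def[abs_def])
  qed
  define x where "x n = nu_increment p f (r n) / (1 - r n)" for n
  define c where "c n = (1 - r n powr \<theta>) / (1 - r n)" for n
  define d where "d n = p / r n powr \<theta>" for n
  have x0: "0 \<le> x n" for n
    unfolding x_def using nu_increment_nonneg[OF p f_space, of "r n"] r[of n] by simp
  have M0: "0 \<le> M" by (simp add: M_def)
  have clim: "c \<longlonglongrightarrow> \<theta>"
    unfolding c_def[abs_def] by (rule powr_difference_quotient_at_1[OF r(2) rlim])
  have "(\<lambda>n. p / r n powr \<theta>) \<longlonglongrightarrow> p / 1 powr \<theta>"
    by (intro tendsto_intros rlim) auto
  hence dlim: "d \<longlonglongrightarrow> p" by (simp add: d_def[abs_def])
  have d0: "0 < d n" for n using p r[of n] by (simp add: d_def)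
  have x_le: "x n \<le> d n * (M / S * t powr (1 / p) - c n)"
    if t: "nu_increment p f (sqrt (r n)) / (1 - r n) \<le> t" for n t
  proof -
    have nn: "0 \<le> nu_increment p f (sqrt (r n)) / (1 - r n)"
      using nu_increment_nonneg[OF p f_space, of "sqrt (r n)"] r[of n] by simp
    have "S * (c n + r n powr \<theta> * x n / p) \<le> M * (nu_increment p f (sqrt (r n)) / (1 - r n)) powr (1 / p)"
      using extremal_increment_bound[OF r intk] by (simp add: c_def x_def M_def \<theta>_def)
    also have "\<dots> \<le> M * t powr (1 / p)"
      using t nn p M0 by (intro mult_left_mono powr_mono2) auto
    finally have "c n + r n powr \<theta> * x n / p \<le> M / S * t powr (1 / p)"
      using S by (simp add: field_simps)
    moreover have "r n powr \<theta> * x n / p = x n / d n" by (simp add: d_def)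
    ultimately have "x n / d n \<le> M / S * t powr (1 / p) - c n" by simp
    thus ?thesis using d0[of n] by (simp add: pos_divide_le_eq mult.commute)
  qed
  show int: "integrable lborel (\<lambda>w. cmod (f w) powr p * \<kappa> w)"
  proof -
    obtain C where C: "C > 0" "\<And>n. \<bar>c n\<bar> \<le> C"
      using convergent_imp_Bseq[OF convergentI[OF clim]] by (auto simp: Bseq_def)
    obtain E where E: "E > 0" "\<And>n. \<bar>d n\<bar> \<le> E"
      using convergent_imp_Bseq[OF convergentI[OF dlim]] by (auto simp: Bseq_def)
    define K where "K = E * (M / S + C)"
    have K0: "0 \<le> K" unfolding K_def using E C M0 S by (intro mult_nonneg_nonneg add_nonneg_nonneg) auto
    have "x n \<le> 1 + (2 * K) powr q" for n
    proof (rule le_of_le_mult_one_plus_powr[OF p q x0 K0])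
      \<comment> \<open>The increment decreases in the dilation factor, so the quotient at
        \<open>sqrt (r n)\<close> is at most \<open>x n\<close>.\<close>
      have "r n \<le> sqrt (r n)"
        using r[of n] by (simp add: real_le_rsqrt power2_eq_square mult_left_le)
      hence "nu_increment p f (sqrt (r n)) \<le> nu_increment p f (r n)"
        using r[of n] by (intro nu_increment_antimono[OF p f_space]) auto
      hence "nu_increment p f (sqrt (r n)) / (1 - r n) \<le> x n"
        unfolding x_def using r[of n] by (intro divide_right_mono) auto
      hence "x n \<le> d n * (M / S * x n powr (1 / p) - c n)" by (rule x_le)
      also have "\<dots> \<le> d n * ((M / S + C) * (1 + x n powr (1 / p)))"
      proof (intro mult_left_mono)
        have "M / S * x n powr (1 / p) - c n \<le> M / S * x n powr (1 / p) + C"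
          using C(2)[of n] by linarith
        also have "\<dots> \<le> (M / S + C) * (1 + x n powr (1 / p))"
          using M0 S C(1) by (simp add: algebra_simps)
        finally show "M / S * x n powr (1 / p) - c n \<le> (M / S + C) * (1 + x n powr (1 / p))" .
      qed (use d0[of n] in auto)
      also have "\<dots> \<le> E * ((M / S + C) * (1 + x n powr (1 / p)))"
        using E(2)[of n] M0 S C(1) by (intro mult_right_mono mult_nonneg_nonneg add_nonneg_nonneg) auto
      finally show "x n \<le> K * (1 + x n powr (1 / p))" by (simp add: K_def mult.assoc)
    qed
    thus ?thesis
      by (intro kappa_integral_le_limit(1)[OF p f_space r rlim, where y = "\<lambda>_. 1 + (2 * K) powr q"])
         (auto simp: x_def)
  qed
  have "x n \<le> d n * (M / S * D powr (1 / p) - c n)" for n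
  proof (rule x_le)
    \<comment> \<open>At the square root the factor 1 - s^2 is exactly \<open>1 - r n\<close>, so no
      factor 2 is lost in the quotient.\<close>
    have "nu_increment p f (sqrt (r n)) \<le> (1 - (sqrt (r n))\<^sup>2) * D"
      unfolding D_def using r[of n] by (intro nu_increment_le[OF p f_space _ _ int]) auto
    thus "nu_increment p f (sqrt (r n)) / (1 - r n) \<le> D"
      using r[of n] by (simp add: pos_divide_le_eq mult.commute)
  qed
  moreover have "(\<lambda>n. d n * (M / S * D powr (1 / p) - c n)) \<longlonglongrightarrow> p * (M / S * D powr (1 / p) - \<theta>)"
    by (intro tendsto_intros dlim clim)
  ultimately have "2 * D \<le> p * (M / S * D powr (1 / p) - \<theta>)"
    unfolding D_def x_def by (intro kappa_integral_le_limit(2)[OF p f_space r rlim])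
  thus "2 * D + (p - 2) \<le> p * (M / S) * D powr (1 / p)"
    using p by (simp add: \<theta>_def algebra_simps)
qed

text \<open>The lower and the upper bound for the increment at s = 1/2 share the factor 3/4, which
  cancels.\<close>

lemma extremal_kappa_ge_1:
  assumes "integrable lborel (\<lambda>w. cmod (f w) powr p * \<kappa> w)"
  shows "1 \<le> (\<integral>w. cmod (f w) powr p * \<kappa> w \<partial>lborel)"
  using nu_increment_ge[OF p f_space, of "1 / 2"] nu_increment_le[OF p f_space _ _ assms, of "1 / 2"]
  by (simp add: integral_f_eq_1 power2_eq_square)

end

text \<open>The Bochner integral of a non-integrable function is 0, so an infinite D_q(k) would
  appear as 0. Its finiteness is therefore a premise (an infinite right side bounds nothing), and
  finiteness of D_p(f) is part of the conclusion.\<close>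

theorem theorem3p1:
  fixes p q phat :: real and \<omega> :: "real \<Rightarrow> real" and k f :: "complex \<Rightarrow> complex"
  assumes p: "1 < p" and q: "q = p / (p - 1)" and phat: "phat = max (p - 1) 1"
    and an: "analytic_near_halfline \<omega>"
    and pos: "\<forall>x\<ge>0. \<omega> x > 0"
    and noninc: "\<forall>x y. 0 \<le> x \<longrightarrow> x \<le> y \<longrightarrow> \<omega> y \<le> \<omega> x"
    and noncst: "\<exists>x y. 0 \<le> x \<and> 0 \<le> y \<and> \<omega> x \<noteq> \<omega> y"
    and lim1: "\<forall>n::int. ((\<lambda>r. r powi n * \<omega> (r^2)) \<longlongrightarrow> 0) at_top"
    and lim2: "\<forall>n::int. ((\<lambda>r. r powi n * deriv \<omega> (r^2)) \<longlongrightarrow> 0) at_top"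
    and dense1: "polys_dense p (\<lambda>z. \<omega> ((cmod z)^2))"
    and dense2: "polys_dense q (\<lambda>z. \<omega> ((cmod z)^2) - (cmod z)^2 * deriv \<omega> ((cmod z)^2))"
    and k: "k \<in> Ap_space q (\<lambda>z. \<omega> ((cmod z)^2))" and knz: "k \<noteq> (\<lambda>z. 0)"
    and f: "is_extremal p (\<lambda>z. \<omega> ((cmod z)^2)) k f"
  shows "integrable lborel (D_integrand \<omega> q k) \<longrightarrow>
           integrable lborel (D_integrand \<omega> p f) \<and>
           D_inf \<omega> p f \<le>
             (phat / dual_norm p (\<lambda>z. \<omega> ((cmod z)^2)) k * D_inf \<omega> q k) powr (1 / (p - 1))"
proof (intro impI)
  assume intk: "integrable lborel (D_integrand \<omega> q k)"
  interpret radial_weight \<omega>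
    using analytic_near_halfline_deriv[OF an] pos noninc by unfold_locales auto
  have nu: "(\<lambda>z. \<omega> ((cmod z)\<^sup>2)) = \<nu>" by (simp add: \<nu>_def[abs_def])
  interpret radial_extremal \<omega> p q k f
    by unfold_locales (use p q k f in \<open>simp_all add: nu\<close>)
  have Dint: "D_integrand \<omega> a g = (\<lambda>w. cmod (g w) powr a * \<kappa> w)" for a g
    by (auto simp: D_integrand_def \<kappa>_def)
  have S: "S > 0" using S_pos lim1 knz by blast
  define D where "D = (\<integral>w. cmod (f w) powr p * \<kappa> w \<partial>lborel)"
  define m where "m = D_inf \<omega> q k / S"
  have m0: "0 \<le> m" using S by (simp add: m_def D_inf_def)
  note bound = extremal_kappa_bound[OF S intk[unfolded Dint]]
  have D1: "1 \<le> D" unfolding D_def by (rule extremal_kappa_ge_1[OF bound(1)])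
  have le: "2 * D + (p - 2) \<le> p * (m * D powr (1 / p))"
    using bound(2) by (simp add: D_def m_def D_inf_def Dint)
  \<comment> \<open>The term \<open>p - 2\<close> is dropped when p >= 2, and then p <= 2 (p - 1).
    When p < 2, \<open>D1\<close> gives 2 - p <= (2 - p) D, which leaves p D on the left.\<close>
  have D_le: "D \<le> phat * m * D powr (1 / p)"
  proof (cases "p \<ge> 2")
    case True
    have "2 * D \<le> p * (m * D powr (1 / p))" using le True by simp
    also have "\<dots> \<le> (2 * phat) * (m * D powr (1 / p))"
      using True m0 by (intro mult_right_mono) (auto simp: phat)
    finally show ?thesis by simp
  next
    case False
    have "p * D \<le> 2 * D + (p - 2)"
      using mult_left_mono[OF D1, of "2 - p"] False by (simp add: algebra_simps)
    with le have "p * D \<le> p * (m * D powr (1 / p))" by linarith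
    hence "D \<le> m * D powr (1 / p)" using p by simp
    thus ?thesis using False by (simp add: phat)
  qed
  \<comment> \<open>Cancelling D^(1/p) leaves the exponent 1 - 1/p = (p - 1)/p, which the power 1/(p
    - 1) turns into 1/p.\<close>
  have "D powr (1 / p) * D powr (1 - 1 / p) = D" using D1 by (simp flip: powr_add)
  hence "D powr (1 / p) * D powr (1 - 1 / p) \<le> D powr (1 / p) * (phat * m)"
    using D_le by (simp add: mult_ac)
  hence "D powr (1 - 1 / p) \<le> phat * m" using D1 by (simp add: mult_le_cancel_left)
  hence "(D powr (1 - 1 / p)) powr (1 / (p - 1)) \<le> (phat * m) powr (1 / (p - 1))"
    using p by (intro powr_mono2) auto
  moreover have "(1 - 1 / p) * (1 / (p - 1)) = 1 / p" using p by (simp add: field_simps)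
  ultimately have "D powr (1 / p) \<le> (phat * m) powr (1 / (p - 1))" by (simp only: powr_powr)
  thus "integrable lborel (D_integrand \<omega> p f) \<and>
      D_inf \<omega> p f \<le> (phat / dual_norm p (\<lambda>z. \<omega> ((cmod z)^2)) k * D_inf \<omega> q k) powr (1 / (p - 1))"
    using bound(1) by (simp add: nu dual_norm_eq Dint D_inf_def m_def D_def)
qed

end
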